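(* Let $K$ be an algebraically closed field of characteristic $0$. Then for each $k\in\{2,3\}$ there is no non-trivial grading $\Gamma$ on $M_k(K)$ by a finite abelian group such that $(M_k(K),\Gamma)$ satisfies the primeness property for graded central polynomials.
   Context: A grading $A=\bigoplus_{g\in G}A_g$ by a finite abelian group $G$ (written additively) is a decomposition into subspaces with $A_gA_h\subseteq A_{g+h}$; it is trivial if $A_g=0$ for all $g\neq 0$. $K\langle X_G\rangle$ is the free unitary associative $G$-graded algebra on countably infinite disjoint sets $X_g$ ($g\in G$) of variables of degree $g$, written $x_i^{(g)}$. Let $A=\bigoplus_{g\in G}A_g$ be a $G$-graded algebra. A polynomial $f(x_1^{(g_1)},\dots,x_n^{(g_n)})\in K\langle X_G\rangle$ is a graded identity of $A$ if it vanishes under all substitutions $x_i^{(g_i)}\mapsto a_i\in A_{g_i}$; it is a graded central polynomial if all these values lie in the centre $Z(A)$; it is a proper graded central polynomial if moreover it is not a graded identity. $A$ satisfies the primeness property for graded central polynomials if, whenever $f,g\in K\langle X_G\rangle$ are polynomials in disjoint sets of variables such that $fg$ is a proper graded central polynomial, both $f$ and $g$ are proper graded central polynomials. *)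

theory Defs
  imports
    "HOL-Analysis.Analysis"
    "HOL-Library.Poly_Mapping"
    "HOL-Computational_Algebra.Polynomial"
begin

subsection \<open>The free graded algebra\<close>

text \<open>
  Words form the free monoid, written additively because \<^theory>\<open>HOL-Library.Poly_Mapping\<close>
  builds the convolution product of finitely supported functions from \<^class>\<open>monoid_add\<close>.
  A copy of the type of lists is used so that no class instance for lists is introduced.
\<close>

datatype 'v monomial = Monomial (letters: "'v list")

instantiation monomial :: (type) monoid_add
begin

definition zero_monomial :: "'a monomial"
  where "0 = Monomial []"

definition plus_monomial :: "'a monomial \<Rightarrow> 'a monomial \<Rightarrow> 'a monomial"
  where "u + v = Monomial (letters u @ letters v)"

instance
  by standard (simp_all add: zero_monomial_def plus_monomial_def)

end

text \<open>
  The monoid algebra of words is the free unitary associative algebra.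
  The variable \<open>x\<^sub>i\<close> of degree \<open>g\<close> is the pair \<open>(g, i)\<close>.
\<close>

type_synonym ('k, 'g) graded_poly = "('g \<times> nat) monomial \<Rightarrow>\<^sub>0 'k"

definition vars :: "('k::zero, 'g) graded_poly \<Rightarrow> ('g \<times> nat) set"
  where "vars f = (\<Union>w\<in>Poly_Mapping.keys f. set (letters w))"

subsection \<open>Graded algebras and graded central polynomials\<close>

locale unital_algebra = vector_space scale
  for scale :: "'k::field \<Rightarrow> 'a::ab_group_add \<Rightarrow> 'a" (infixr \<open>\<odot>\<close> 75) +
  fixes mult :: "'a \<Rightarrow> 'a \<Rightarrow> 'a" (infixl \<open>\<cdot>\<close> 70)
    and one :: 'a (\<open>\<one>\<close>)
  assumes mult_assoc: "(a \<cdot> b) \<cdot> c = a \<cdot> (b \<cdot> c)"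
    and one_mult: "\<one> \<cdot> a = a"
    and mult_one: "a \<cdot> \<one> = a"
    and mult_add_left: "(a + b) \<cdot> c = a \<cdot> c + b \<cdot> c"
    and mult_add_right: "a \<cdot> (b + c) = a \<cdot> b + a \<cdot> c"
    and mult_scale_left: "(r \<odot> a) \<cdot> b = r \<odot> (a \<cdot> b)"
    and mult_scale_right: "a \<cdot> (r \<odot> b) = r \<odot> (a \<cdot> b)"
begin

definition grading :: "('g::{finite,ab_group_add} \<Rightarrow> 'a set) \<Rightarrow> bool"
  where "grading A \<longleftrightarrow>
    (\<forall>g. subspace (A g)) \<and>
    (\<forall>a. \<exists>!c. (\<forall>g. c g \<in> A g) \<and> a = (\<Sum>g\<in>UNIV. c g)) \<and>
    (\<forall>g h. \<forall>a\<in>A g. \<forall>b\<in>A h. a \<cdot> b \<in> A (g + h))"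

definition trivial_grading :: "('g::{finite,ab_group_add} \<Rightarrow> 'a set) \<Rightarrow> bool"
  where "trivial_grading A \<longleftrightarrow> (\<forall>g. g \<noteq> 0 \<longrightarrow> A g = {0})"

definition centre :: "'a set"
  where "centre = {z. \<forall>a. z \<cdot> a = a \<cdot> z}"

definition eval_monomial :: "('v \<Rightarrow> 'a) \<Rightarrow> 'v monomial \<Rightarrow> 'a"
  where "eval_monomial s w = foldr (\<lambda>x a. s x \<cdot> a) (letters w) \<one>"

definition eval_poly :: "('g \<times> nat \<Rightarrow> 'a) \<Rightarrow> ('k, 'g) graded_poly \<Rightarrow> 'a"
  where "eval_poly s f = (\<Sum>w\<in>Poly_Mapping.keys f. Poly_Mapping.lookup f w \<odot> eval_monomial s w)"

definition graded_subst :: "('g \<Rightarrow> 'a set) \<Rightarrow> ('g \<times> nat \<Rightarrow> 'a) \<Rightarrow> bool"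
  where "graded_subst A s \<longleftrightarrow> (\<forall>g i. s (g, i) \<in> A g)"

definition graded_identity :: "('g \<Rightarrow> 'a set) \<Rightarrow> ('k, 'g) graded_poly \<Rightarrow> bool"
  where "graded_identity A f \<longleftrightarrow> (\<forall>s. graded_subst A s \<longrightarrow> eval_poly s f = 0)"

definition graded_central :: "('g \<Rightarrow> 'a set) \<Rightarrow> ('k, 'g) graded_poly \<Rightarrow> bool"
  where "graded_central A f \<longleftrightarrow> (\<forall>s. graded_subst A s \<longrightarrow> eval_poly s f \<in> centre)"

definition proper_graded_central :: "('g \<Rightarrow> 'a set) \<Rightarrow> ('k, 'g) graded_poly \<Rightarrow> bool"
  where "proper_graded_central A f \<longleftrightarrow> graded_central A f \<and> \<not> graded_identity A f"

definition primeness_property :: "('g \<Rightarrow> 'a set) \<Rightarrow> bool"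
  where "primeness_property A \<longleftrightarrow>
    (\<forall>f g. vars f \<inter> vars g = {} \<longrightarrow> proper_graded_central A (f * g) \<longrightarrow>
      proper_graded_central A f \<and> proper_graded_central A g)"

end

subsection \<open>The full matrix algebra\<close>

text \<open>
  The product \<open>*\<close> of the type \<open>'k^'n^'n\<close> is componentwise, so the algebra structure is
  given explicitly, with \<open>**\<close> as multiplication.
\<close>

definition scale_matrix :: "'k::field \<Rightarrow> 'k^'n^'m \<Rightarrow> 'k^'n^'m"
  where "scale_matrix c M = (\<chi> i j. c * M $ i $ j)"

interpretation matrix_algebra:
  unital_algebra scale_matrix "(**) :: 'k::field^'n^'n \<Rightarrow> 'k^'n^'n \<Rightarrow> 'k^'n^'n" "mat 1"
proof
  fix r :: 'k and A B C :: "'k^'n^'n"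
  show "(A + B) ** C = A ** C + B ** C"
    by (simp add: matrix_matrix_mult_def vec_eq_iff distrib_right sum.distrib)
  show "scale_matrix r A ** B = scale_matrix r (A ** B)"
    and "A ** scale_matrix r B = scale_matrix r (A ** B)"
    by (simp_all add: scale_matrix_def matrix_matrix_mult_def vec_eq_iff sum_distrib_left mult_ac)
qed (simp_all add: scale_matrix_def vec_eq_iff algebra_simps matrix_add_ldistrib
    flip: matrix_mul_assoc)

end

theory Submission
  imports Defs
begin

text \<open>
  A product \<open>f * g\<close> of polynomials in disjoint variables takes as values all products of a value of \<open>f\<close>
  with a value of \<open>g\<close>. So the primeness property fails as soon as some invertible, non-scalar matrix
  \<open>X\<close> admits non-identities \<open>f\<close> with values on the line through \<open>X\<close> and \<open>g\<close> with values on the line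
  through the inverse of \<open>X\<close> (\<open>not_primeness_property_if_values_inverse_lines\<close>). The proof
  exhibits such a pair for every non-trivial grading.

  Write \<open>A\<^sub>g\<close> for the homogeneous components. The functional that sends a matrix to the trace of its
  component of degree zero vanishes on commutators and therefore is the trace (\<open>trace_component_zero\<close>).
  Hence the trace pairs \<open>A\<^sub>g\<close> with \<open>A\<^sub>-\<^sub>g\<close> without degeneracy. If \<open>A\<^sub>0\<close> consists of scalars, it follows
  that every component is zero or a line spanned by an invertible matrix, and two variables of opposite nonzero degrees
  form the required pair (\<open>not_primeness_property_if_degree_zero_scalar\<close>).

  Otherwise the minimal polynomial of a non-scalar element of \<open>A\<^sub>0\<close> yields two nonzero elements of
  \<open>A\<^sub>0\<close> with product zero. In size at most three one of them has rank one, and the trace pairing on \<open>A\<^sub>0\<close>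
  turns it into an idempotent \<open>e\<close> of rank one (\<open>ex_rank_one_idempotent_degree_zero\<close>). The left ideal
  generated by \<open>e\<close> is a graded copy of the column space. A homogeneous basis of it gives coordinates in which
  each matrix unit is homogeneous, of degree \<open>d i - d j\<close> (\<open>ex_homogeneous_coordinates\<close>). This
  elementary argument replaces the classification of gradings on matrix algebras.

  As the grading is non-trivial, \<open>d\<close> is not constant. In order two, the commutator of elements of opposite degrees
  \<open>d p - d q\<close> and \<open>d q - d p\<close> has values that are multiples of \<open>diag(1, -1)\<close>. In order three with distinct degrees, a sum of
  the three cyclic shifts of a monomial, weighted by a primitive cube root of unity \<open>\<omega>\<close>, has values
  that are multiples of \<open>diag(1, \<omega>, \<omega>\<^sup>2)\<close>. If exactly two degrees agree, a polynomial based on the identity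
  \<open>t m + m t = trace (t m)\<close> for traceless matrices of order two has values that are multiples of \<open>diag(1, 1, -1)\<close>.
\<close>

section \<open>Evaluation in the free graded algebra\<close>

abbreviation variable :: "'g \<times> nat \<Rightarrow> ('k::field, 'g) graded_poly"
  where "variable x \<equiv> Poly_Mapping.single (Monomial [x]) 1"

abbreviation scalar :: "'k \<Rightarrow> ('k::field, 'g) graded_poly"
  where "scalar c \<equiv> Poly_Mapping.single 0 c"

lemma vars_variable: "vars (variable x :: ('k::field, 'g) graded_poly) = {x}"
  by (simp add: vars_def)

lemma vars_scalar: "vars (scalar c) = {}"
  by (simp add: vars_def zero_monomial_def)

lemma vars_add: "vars (f + g) \<subseteq> vars f \<union> vars g"
  using keys_add[of f g] by (auto simp: vars_def)

lemma vars_diff: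
  fixes f g :: "('k::field, 'g) graded_poly"
  shows "vars (f - g) \<subseteq> vars f \<union> vars g"
  using keys_diff[of f g] by (auto simp: vars_def)

lemma vars_mult:
  fixes f g :: "('k::field, 'g) graded_poly"
  shows "vars (f * g) \<subseteq> vars f \<union> vars g"
  using keys_mult[of f g] by (fastforce simp: vars_def plus_monomial_def)

lemma vars_add_subset: "vars f \<subseteq> V \<Longrightarrow> vars g \<subseteq> V \<Longrightarrow> vars (f + g) \<subseteq> V"
  using vars_add[of f g] by blast

lemma vars_diff_subset:
  fixes f g :: "('k::field, 'g) graded_poly"
  shows "vars f \<subseteq> V \<Longrightarrow> vars g \<subseteq> V \<Longrightarrow> vars (f - g) \<subseteq> V"
  using vars_diff[of f g] by blast

lemma vars_mult_subset:
  fixes f g :: "('k::field, 'g) graded_poly"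
  shows "vars f \<subseteq> V \<Longrightarrow> vars g \<subseteq> V \<Longrightarrow> vars (f * g) \<subseteq> V"
  using vars_mult[of f g] by blast

lemmas vars_subset_intros = vars_add_subset vars_diff_subset vars_mult_subset

lemma poly_mapping_eq_sum_single:
  fixes f :: "'a \<Rightarrow>\<^sub>0 'b::comm_monoid_add"
  shows "f = (\<Sum>w\<in>Poly_Mapping.keys f. Poly_Mapping.single w (Poly_Mapping.lookup f w))"
  by (rule poly_mapping_eqI)
    (simp add: lookup_sum lookup_single when_def in_keys_iff)

context unital_algebra
begin

lemma mult_zero_left [simp]: "0 \<cdot> a = 0" and mult_zero_right [simp]: "a \<cdot> 0 = 0"
  using mult_add_left[of 0 0 a] mult_add_right[of a 0 0] by simp_all

lemma mult_sum_left: "sum f S \<cdot> a = (\<Sum>x\<in>S. f x \<cdot> a)"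
  by (induction S rule: infinite_finite_induct) (simp_all add: mult_add_left)

lemma mult_sum_right: "a \<cdot> sum f S = (\<Sum>x\<in>S. a \<cdot> f x)"
  by (induction S rule: infinite_finite_induct) (simp_all add: mult_add_right)

lemma eval_monomial_plus: "eval_monomial s (u + v) = eval_monomial s u \<cdot> eval_monomial s v"
proof -
  have "foldr (\<lambda>x a. s x \<cdot> a) (xs @ ys) \<one> = foldr (\<lambda>x a. s x \<cdot> a) xs \<one> \<cdot> foldr (\<lambda>x a. s x \<cdot> a) ys \<one>"
    for xs ys
    by (induction xs) (simp_all add: one_mult mult_assoc)
  then show ?thesis
    by (simp add: eval_monomial_def plus_monomial_def)
qed

lemma eval_poly_eq_sum:
  assumes "finite S" "Poly_Mapping.keys f \<subseteq> S"
  shows "eval_poly s f = (\<Sum>w\<in>S. Poly_Mapping.lookup f w \<odot> eval_monomial s w)"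
  unfolding eval_poly_def using assms
  by (intro sum.mono_neutral_left) (auto simp: in_keys_iff)

lemma eval_poly_single: "eval_poly s (Poly_Mapping.single w c) = c \<odot> eval_monomial s w"
  by (subst eval_poly_eq_sum[of "{w}"]) auto

lemma eval_poly_variable: "eval_poly s (variable x) = s x"
  by (simp add: eval_poly_single eval_monomial_def mult_one)

lemma eval_poly_scalar: "eval_poly s (scalar c) = c \<odot> \<one>"
  by (simp add: eval_poly_single eval_monomial_def zero_monomial_def)

lemma eval_poly_add: "eval_poly s (f + g) = eval_poly s f + eval_poly s g"
proof -
  let ?S = "Poly_Mapping.keys f \<union> Poly_Mapping.keys g"
  have "eval_poly s h = (\<Sum>w\<in>?S. Poly_Mapping.lookup h w \<odot> eval_monomial s w)"
    if "Poly_Mapping.keys h \<subseteq> ?S" for h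
    using that by (intro eval_poly_eq_sum) auto
  then show ?thesis
    using keys_add[of f g] by (simp add: lookup_add scale_left_distrib sum.distrib)
qed

lemma eval_poly_diff: "eval_poly s (f - g) = eval_poly s f - eval_poly s g"
  using eval_poly_add[of s "f - g" g] by simp

lemma eval_poly_sum: "eval_poly s (sum F S) = (\<Sum>x\<in>S. eval_poly s (F x))"
proof (induction S rule: infinite_finite_induct)
  case (insert x S)
  then show ?case by (simp add: eval_poly_add)
qed (simp_all add: eval_poly_def)

lemma eval_poly_mult: "eval_poly s (f * g) = eval_poly s f \<cdot> eval_poly s g"
proof -
  let ?F = "Poly_Mapping.keys f" and ?G = "Poly_Mapping.keys g"
  have "f * g = (\<Sum>u\<in>?F. \<Sum>v\<in>?G. Poly_Mapping.single (u + v)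
      (Poly_Mapping.lookup f u * Poly_Mapping.lookup g v))"
    by (subst poly_mapping_eq_sum_single[of f], subst poly_mapping_eq_sum_single[of g])
      (simp add: sum_product mult_single)
  then have "eval_poly s (f * g) = (\<Sum>u\<in>?F. \<Sum>v\<in>?G.
      (Poly_Mapping.lookup f u * Poly_Mapping.lookup g v) \<odot> (eval_monomial s u \<cdot> eval_monomial s v))"
    by (simp add: eval_poly_sum eval_poly_single eval_monomial_plus)
  also have "\<dots> = eval_poly s f \<cdot> eval_poly s g"
    unfolding eval_poly_def mult_sum_left mult_sum_right
    by (subst sum.swap) (simp add: mult_scale_left mult_scale_right mult.commute)
  finally show ?thesis .
qed

lemmas eval_poly_simps = eval_poly_variable eval_poly_scalar eval_poly_add eval_poly_diff eval_poly_mult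

lemma eval_poly_cong:
  assumes "\<And>x. x \<in> vars f \<Longrightarrow> s x = t x"
  shows "eval_poly s f = eval_poly t f"
proof -
  have "eval_monomial s w = eval_monomial t w" if "w \<in> Poly_Mapping.keys f" for w
  proof -
    have "s x = t x" if "x \<in> set (letters w)" for x
      using that \<open>w \<in> _\<close> by (intro assms) (auto simp: vars_def)
    then show ?thesis
      unfolding eval_monomial_def by (intro foldr_cong) simp_all
  qed
  then show ?thesis
    by (simp add: eval_poly_def)
qed

section \<open>Polynomials with values in mutually inverse lines\<close>

text \<open>
  Since \<open>f\<close> and \<open>g\<close> share no variable, their values can be prescribed independently. Hence
  \<open>f * g\<close> is proper central as a product of inverse directions, while \<open>f\<close> itself
  takes the non-central value \<open>c \<odot> X\<close>. Every failure of the primeness property below is an instance of this.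
\<close>

lemma not_primeness_property_if_values_inverse_lines:
  assumes XY: "X \<cdot> Y = \<one>" and X: "X \<notin> centre"
    and disj: "vars f \<inter> vars g = {}"
    and f: "\<And>s. graded_subst A s \<Longrightarrow> \<exists>c. eval_poly s f = c \<odot> X"
    and g: "\<And>s. graded_subst A s \<Longrightarrow> \<exists>c. eval_poly s g = c \<odot> Y"
    and s: "graded_subst A s" "eval_poly s f \<noteq> 0"
    and t: "graded_subst A t" "eval_poly t g \<noteq> 0"
  shows "\<not> primeness_property A"
proof
  assume prime: "primeness_property A"
  have fg: "\<exists>c d. eval_poly u f = c \<odot> X \<and> eval_poly u g = d \<odot> Y
      \<and> eval_poly u (f * g) = (c * d) \<odot> \<one>" if u: "graded_subst A u" for u
  proof -
    obtain c d where "eval_poly u f = c \<odot> X" "eval_poly u g = d \<odot> Y"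
      using f[OF u] g[OF u] by blast
    then show ?thesis
      by (intro exI[of _ c] exI[of _ d])
        (simp add: eval_poly_mult mult_scale_left mult_scale_right XY mult.commute)
  qed
  then have "graded_central A (f * g)"
    unfolding graded_central_def centre_def
    by (force simp: mult_scale_left mult_scale_right one_mult mult_one)
  moreover have "\<not> graded_identity A (f * g)"
  proof
    assume ident: "graded_identity A (f * g)"
    \<comment> \<open>The variables are disjoint, so both nonzero values are reached by one substitution.\<close>
    define u where "u x = (if x \<in> vars f then s x else t x)" for x
    have u: "graded_subst A u"
      using s t by (simp add: u_def graded_subst_def)
    have "eval_poly u f = eval_poly s f" "eval_poly u g = eval_poly t g"
      using disj by (auto simp: u_def intro!: eval_poly_cong)
    moreover obtain c d where cd: "eval_poly u f = c \<odot> X" "eval_poly u g = d \<odot> Y"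
      "eval_poly u (f * g) = (c * d) \<odot> \<one>"
      using fg[OF u] by blast
    ultimately have "c \<noteq> 0" "d \<noteq> 0" "(c * d) \<odot> \<one> = 0"
      using s t ident u by (auto simp: graded_identity_def)
    then have "\<one> = 0" by simp
    then have "X = 0" using mult_one[of X] by simp
    then show False using cd s \<open>eval_poly u f = eval_poly s f\<close> by simp
  qed
  ultimately have "graded_central A f"
    using prime disj by (auto simp: primeness_property_def proper_graded_central_def)
  then have "eval_poly s f \<in> centre"
    using s by (simp add: graded_central_def)
  moreover obtain c where c: "eval_poly s f = c \<odot> X"
    using f s by blast
  moreover have "c \<noteq> 0" using c s by auto
  ultimately have "X \<in> centre"
    by (simp add: centre_def mult_scale_left mult_scale_right)
  with X show False ..
qed

section \<open>Homogeneous components\<close>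

text \<open>
  The description operator is harmless, because a grading makes the decomposition unique. Outside gradings
  the value is arbitrary.
\<close>

definition component :: "('g::{finite,ab_group_add} \<Rightarrow> 'a set) \<Rightarrow> 'a \<Rightarrow> 'g \<Rightarrow> 'a"
  where "component A a = (THE c. (\<forall>g. c g \<in> A g) \<and> a = (\<Sum>g\<in>UNIV. c g))"

context
  fixes A :: "'g::{finite,ab_group_add} \<Rightarrow> 'a set"
  assumes A: "grading A"
begin

lemma grading_subspace: "subspace (A g)"
  and grading_mult: "a \<in> A g \<Longrightarrow> b \<in> A h \<Longrightarrow> a \<cdot> b \<in> A (g + h)"
  using A by (auto simp: grading_def)

lemma component_ex1: "\<exists>!c. (\<forall>g. c g \<in> A g) \<and> a = (\<Sum>g\<in>UNIV. c g)"
  using A by (simp add: grading_def)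

lemma component_mem: "component A a g \<in> A g"
  and sum_component: "(\<Sum>g\<in>UNIV. component A a g) = a"
  using theI'[OF component_ex1[of a]] by (auto simp: component_def)

lemma component_eqI:
  assumes "\<And>g. c g \<in> A g" "a = (\<Sum>g\<in>UNIV. c g)"
  shows "component A a = c"
  unfolding component_def using assms by (intro the1_equality[OF component_ex1]) auto

lemma component_homogeneous:
  assumes "a \<in> A h"
  shows "component A a = (\<lambda>g. if g = h then a else 0)"
  using assms by (intro component_eqI) (auto intro: subspace_0[OF grading_subspace])

lemma component_add: "component A (a + b) g = component A a g + component A b g"
proof -
  have "component A (a + b) = (\<lambda>g. component A a g + component A b g)"
    by (intro component_eqI)
      (auto intro: subspace_add[OF grading_subspace] component_mem simp: sum.distrib sum_component)
  then show ?thesis by simp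
qed

lemma component_scale: "component A (c \<odot> a) g = c \<odot> component A a g"
proof -
  have "component A (c \<odot> a) = (\<lambda>g. c \<odot> component A a g)"
    by (intro component_eqI)
      (auto intro: subspace_scale[OF grading_subspace] component_mem simp: sum_component simp flip: scale_sum_right)
  then show ?thesis by simp
qed

lemma component_sum: "component A (sum f S) g = (\<Sum>x\<in>S. component A (f x) g)"
proof -
  have "component A 0 g = 0"
    using component_scale[of 0 0 g] by simp
  then show ?thesis
    by (induction S rule: infinite_finite_induct) (simp_all add: component_add)
qed

lemma component_mult:
  "component A (a \<cdot> b) k = (\<Sum>g\<in>UNIV. component A a g \<cdot> component A b (k - g))"
proof -
  have "component A (a \<cdot> b) = (\<lambda>k. \<Sum>g\<in>UNIV. component A a g \<cdot> component A b (k - g))"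
  proof (rule component_eqI)
    fix k
    show "(\<Sum>g\<in>UNIV. component A a g \<cdot> component A b (k - g)) \<in> A k"
    proof (intro subspace_sum[OF grading_subspace])
      fix g
      show "component A a g \<cdot> component A b (k - g) \<in> A k"
        using grading_mult[OF component_mem component_mem, of a g b "k - g"] by simp
    qed
  next
    have *: "(\<Sum>k\<in>UNIV. component A b (k - g)) = b" for g
      using sum.reindex_bij_witness[of UNIV "\<lambda>h. h + g" "\<lambda>k. k - g" UNIV
          "component A b" "\<lambda>k. component A b (k - g)"]
      by (simp add: sum_component)
    have "a \<cdot> b = (\<Sum>g\<in>UNIV. component A a g \<cdot> (\<Sum>k\<in>UNIV. component A b (k - g)))"
      by (simp add: * sum_component flip: mult_sum_left)
    also have "\<dots> = (\<Sum>k\<in>UNIV. \<Sum>g\<in>UNIV. component A a g \<cdot> component A b (k - g))"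
      by (simp add: mult_sum_right) (rule sum.swap)
    finally show "a \<cdot> b = (\<Sum>k\<in>UNIV. \<Sum>g\<in>UNIV. component A a g \<cdot> component A b (k - g))" .
  qed
  then show ?thesis by simp
qed

lemma component_mult_homogeneous:
  assumes "b \<in> A h"
  shows "component A (a \<cdot> b) (g + h) = component A a g \<cdot> b"
proof -
  have "component A (a \<cdot> b) (g + h) = (\<Sum>k\<in>UNIV. if k = g then component A a k \<cdot> b else 0)"
    unfolding component_mult
    by (intro sum.cong) (auto simp: component_homogeneous[OF assms] algebra_simps)
  then show ?thesis by simp
qed

text \<open>
  The degree-zero component of \<open>\<one>\<close> acts as a left identity on every homogeneous element
  by uniqueness of components, so it is \<open>\<one>\<close>.
\<close>

lemma one_mem_degree_zero: "\<one> \<in> A 0"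
proof -
  let ?e = "component A \<one> 0"
  have *: "?e \<cdot> a = a" if "a \<in> A h" for a h
    using component_mult_homogeneous[OF that, of \<one> 0] component_homogeneous[OF that]
    by (simp add: one_mult)
  have "?e \<cdot> a = (\<Sum>g\<in>UNIV. ?e \<cdot> component A a g)" for a
    by (subst sum_component[symmetric]) (simp only: mult_sum_right)
  also have "\<dots> a = a" for a
    by (simp add: *[OF component_mem] sum_component)
  finally have "?e = \<one>"
    by (metis mult_one)
  then show ?thesis
    using component_mem by metis
qed

end

end

section \<open>Zero divisors from non-scalar elements\<close>

context unital_algebra
begin

definition poly_at :: "'a \<Rightarrow> 'k poly \<Rightarrow> 'a"
  where "poly_at a p = fold_coeffs (\<lambda>c m. c \<odot> \<one> + a \<cdot> m) p 0"

lemma poly_at_0 [simp]: "poly_at a 0 = 0"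
  by (simp add: poly_at_def)

lemma poly_at_pCons [simp]: "poly_at a (pCons c p) = c \<odot> \<one> + a \<cdot> poly_at a p"
  by (cases "c = 0 \<and> p = 0") (auto simp: poly_at_def)

lemma poly_at_add: "poly_at a (p + q) = poly_at a p + poly_at a q"
  by (induction p q rule: poly_induct2)
    (simp_all add: scale_left_distrib mult_add_right algebra_simps)

lemma poly_at_smult: "poly_at a (smult c p) = c \<odot> poly_at a p"
  by (induction p) (simp_all add: mult_scale_right scale_right_distrib)

lemma poly_at_mult: "poly_at a (p * q) = poly_at a p \<cdot> poly_at a q"
  by (induction p)
    (simp_all add: poly_at_add poly_at_smult mult_add_left mult_scale_left one_mult mult_assoc)

lemma poly_at_sum: "poly_at a (sum F S) = (\<Sum>x\<in>S. poly_at a (F x))"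
  by (induction S rule: infinite_finite_induct) (simp_all add: poly_at_add)

lemma poly_at_mem:
  assumes "subspace S" "\<one> \<in> S" "\<And>x y. x \<in> S \<Longrightarrow> y \<in> S \<Longrightarrow> x \<cdot> y \<in> S" "a \<in> S"
  shows "poly_at a p \<in> S"
proof (induction p)
  case 0
  show ?case using subspace_0[OF assms(1)] by simp
next
  case (pCons c p)
  show ?case
    unfolding poly_at_pCons
    by (intro subspace_add[OF assms(1)] subspace_scale[OF assms(1)] assms(2,3,4) pCons.IH)
qed

lemma ex_annihilating_poly:
  assumes "finite T" "span T = UNIV"
  shows "\<exists>p. p \<noteq> 0 \<and> poly_at a p = 0"
proof -
  let ?f = "\<lambda>i. poly_at a (monom 1 i)"
  let ?I = "{..card T}"
  \<comment> \<open>There are more exponents up to \<open>card T\<close> than a basis can have elements, so two powers coincide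
    or the distinct powers are dependent.\<close>
  show ?thesis
  proof (cases "inj_on ?f ?I")
    case False
    then obtain i j where ij: "i \<noteq> j" "?f i = ?f j"
      by (auto simp: inj_on_def)
    define p :: "'k poly" where "p = monom 1 i + smult (- 1) (monom 1 j)"
    have "poly_at a p = 0"
      unfolding p_def poly_at_add poly_at_smult ij(2) by simp
    moreover have "coeff p i = 1"
      using ij(1) by (simp add: p_def)
    then have "p \<noteq> 0" by auto
    ultimately show ?thesis by blast
  next
    case True
    then have "card (?f ` ?I) = Suc (card T)"
      by (simp add: card_image)
    then have "dependent (?f ` ?I)"
      using independent_span_bound[of T "?f ` ?I"] assms by auto
    then obtain u where u: "\<exists>v\<in>?f ` ?I. u v \<noteq> 0" "(\<Sum>v\<in>?f ` ?I. u v \<odot> v) = 0"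
      using dependent_finite[of "?f ` ?I"] by auto
    define p where "p = (\<Sum>i\<in>?I. monom (u (?f i)) i)"
    have monom: "poly_at a (monom c i) = c \<odot> ?f i" for c i
      by (simp add: poly_at_smult[symmetric] smult_monom)
    have "poly_at a p = (\<Sum>i\<in>?I. u (?f i) \<odot> ?f i)"
      unfolding p_def poly_at_sum by (intro sum.cong refl monom)
    also have "\<dots> = 0"
      using u(2) unfolding sum.reindex[OF True] o_def .
    finally have "poly_at a p = 0" .
    moreover obtain i where i: "i \<in> ?I" "u (?f i) \<noteq> 0"
      using u(1) by auto
    then have "coeff p i \<noteq> 0"
      by (simp add: p_def coeff_sum)
    then have "p \<noteq> 0" by auto
    ultimately show ?thesis by blast
  qed
qed

end

text \<open>
  The minimal polynomial of \<open>a\<close> splits as a linear factor times a cofactor. Their values at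
  \<open>a\<close> have product zero, but neither vanishes: the linear one since \<open>a\<close> is not scalar, the other by
  minimality. As polynomials in \<open>a\<close> they stay inside the subalgebra \<open>S\<close>; in the application \<open>S\<close> is the
  degree-zero part of a grading.
\<close>

lemma ex_zero_divisors_if_not_scalar:
  fixes scale :: "'k::alg_closed_field \<Rightarrow> 'a::ab_group_add \<Rightarrow> 'a" (infixr \<open>\<odot>\<close> 75)
    and mult (infixl \<open>\<cdot>\<close> 70) and one (\<open>\<one>\<close>)
  assumes "unital_algebra scale mult one"
    and fin: "finite T" "module.span scale T = UNIV"
    and S: "module.subspace scale S" "\<one> \<in> S" "\<And>x y. x \<in> S \<Longrightarrow> y \<in> S \<Longrightarrow> x \<cdot> y \<in> S"
    and a: "a \<in> S" "\<And>c. a \<noteq> c \<odot> \<one>"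
  shows "\<exists>b\<in>S. \<exists>c\<in>S. b \<noteq> 0 \<and> c \<noteq> 0 \<and> b \<cdot> c = 0"
proof -
  interpret unital_algebra scale mult one by fact
  let ?P = "\<lambda>p. p \<noteq> 0 \<and> poly_at a p = 0"
  obtain p where p: "?P p" and p_min: "\<And>q. ?P q \<Longrightarrow> degree p \<le> degree q"
    using ex_annihilating_poly[OF fin, of a] ex_has_least_nat[of ?P _ degree] by blast
  have "degree p > 0"
  proof (rule ccontr)
    assume "\<not> degree p > 0"
    then obtain c where c: "p = [:c:]"
      using degree_eq_zeroE by blast
    with p have "\<one> = 0" by auto
    then have "a = 0 \<odot> \<one>"
      using mult_one[of a] by simp
    then show False using a by blast
  qed
  then obtain l where "poly p l = 0"
    using alg_closed_imp_poly_has_root by blast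
  then obtain q where q: "p = [:- l, 1:] * q"
    by (auto simp: poly_eq_0_iff_dvd)
  have "q \<noteq> 0" "degree p = Suc (degree q)"
    using p by (auto simp: q degree_mult_eq simp del: mult_pCons_left)
  then have "poly_at a q \<noteq> 0"
    using p_min[of q] by auto
  moreover have "poly_at a [:- l, 1:] \<noteq> 0"
    using a(2)[of l] by (simp add: mult_one)
  moreover have "poly_at a [:- l, 1:] \<cdot> poly_at a q = 0"
    using p unfolding q poly_at_mult by blast
  ultimately show ?thesis
    using poly_at_mem[OF S a(1)] by blast
qed

section \<open>Matrix units and the trace\<close>

definition matrix_unit :: "'n \<Rightarrow> 'n \<Rightarrow> 'k::field^'n^'n"
  where "matrix_unit i j = (\<chi> r s. if r = i \<and> s = j then 1 else 0)"

lemma matrix_unit_nth [simp]: "matrix_unit i j $ r $ s = (if r = i \<and> s = j then 1 else 0)"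
  by (simp add: matrix_unit_def)

lemma scale_matrix_nth [simp]: "scale_matrix c M $ i $ j = c * M $ i $ j"
  by (simp add: scale_matrix_def)

lemma mat_1_nth: "(mat 1 :: 'k::field^'n^'n) $ i $ j = (if i = j then 1 else 0)"
  by (simp add: mat_def)

lemma matrix_matrix_mult_nth: "(A ** B) $ i $ j = (\<Sum>k\<in>UNIV. A $ i $ k * B $ k $ j)"
  by (simp add: matrix_matrix_mult_def)

lemma matrix_mult_matrix_unit_nth:
  fixes A :: "'k::field^'n^'n"
  shows "(A ** matrix_unit i j) $ r $ s = (if s = j then A $ r $ i else 0)"
    and "(matrix_unit i j ** A) $ r $ s = (if r = i then A $ j $ s else 0)"
proof -
  have "(A ** matrix_unit i j) $ r $ s = (\<Sum>k\<in>UNIV. if k = i then if s = j then A $ r $ i else 0 else 0)"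
    unfolding matrix_matrix_mult_nth by (intro sum.cong) auto
  then show "(A ** matrix_unit i j) $ r $ s = (if s = j then A $ r $ i else 0)"
    by simp
  have "(matrix_unit i j ** A) $ r $ s = (\<Sum>k\<in>UNIV. if k = j then if r = i then A $ j $ s else 0 else 0)"
    unfolding matrix_matrix_mult_nth by (intro sum.cong) auto
  then show "(matrix_unit i j ** A) $ r $ s = (if r = i then A $ j $ s else 0)"
    by simp
qed

lemma matrix_unit_mult:
  "matrix_unit i j ** matrix_unit k l = (if j = k then matrix_unit i l else (0::'k::field^'n^'n))"
  by (auto simp: vec_eq_iff matrix_mult_matrix_unit_nth)

lemma matrix_eq_sum_matrix_units:
  fixes M :: "'k::field^'n^'n"
  shows "M = (\<Sum>i\<in>UNIV. \<Sum>j\<in>UNIV. scale_matrix (M $ i $ j) (matrix_unit i j))"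
proof -
  have "(\<Sum>i\<in>UNIV. \<Sum>j\<in>UNIV. scale_matrix (M $ i $ j) (matrix_unit i j)) $ r $ s = M $ r $ s" for r s
  proof -
    have "(\<Sum>i\<in>UNIV. \<Sum>j\<in>UNIV. scale_matrix (M $ i $ j) (matrix_unit i j)) $ r $ s
      = (\<Sum>i\<in>UNIV. if i = r then \<Sum>j\<in>UNIV. if j = s then M $ r $ s else 0 else 0)"
      unfolding sum_component by (intro sum.cong refl) (auto simp: if_distrib cong: if_cong)
    then show ?thesis by simp
  qed
  then show ?thesis by (simp add: vec_eq_iff)
qed

lemma span_matrix_units:
  "matrix_algebra.span ((\<lambda>(i, j). matrix_unit i j) ` UNIV) = (UNIV :: ('k::field^'n^'n) set)"
proof -
  have "M \<in> matrix_algebra.span ((\<lambda>(i, j). matrix_unit i j) ` UNIV)" for M :: "'k^'n^'n"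
    by (subst matrix_eq_sum_matrix_units)
      (intro matrix_algebra.span_sum matrix_algebra.span_scale matrix_algebra.span_base, force)
  then show ?thesis by blast
qed

lemma centre_matrix_algebra:
  fixes M :: "'k::field^'n^'n"
  assumes "M \<in> matrix_algebra.centre"
  shows "M = scale_matrix (M $ i $ i) (mat 1)"
proof -
  have eq: "M ** matrix_unit r s = matrix_unit r s ** M" for r s
    using assms by (simp add: matrix_algebra.centre_def)
  have entry: "M $ r $ s = (if r = s then M $ i $ i else 0)" for r s
    using arg_cong[OF eq[of s i], of "\<lambda>M. M $ r $ i"]
    by (auto simp: matrix_mult_matrix_unit_nth split: if_splits)
  show ?thesis
    unfolding vec_eq_iff
  proof (intro allI)
    fix r s
    show "M $ r $ s = scale_matrix (M $ i $ i) (mat 1) $ r $ s"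
      using entry[of r s] by (simp add: mat_1_nth)
  qed
qed

text \<open>
  A functional that vanishes on commutators kills the off-diagonal matrix units and agrees on all
  diagonal ones, which leaves one degree of freedom, fixed by the value at the identity.
\<close>

lemma tracial_functional_eq_trace:
  fixes \<tau> :: "'k::field^'n^'n \<Rightarrow> 'k"
  assumes add: "\<And>M N. \<tau> (M + N) = \<tau> M + \<tau> N"
    and scale: "\<And>c M. \<tau> (scale_matrix c M) = c * \<tau> M"
    and comm: "\<And>M N. \<tau> (M ** N) = \<tau> (N ** M)"
  shows "of_nat CARD('n) * \<tau> M = trace M * \<tau> (mat 1)"
proof -
  have zero: "\<tau> 0 = 0"
    using scale[of 0 0] by (simp add: matrix_algebra.scale_zero_left)
  have sum: "\<tau> (sum f S) = (\<Sum>x\<in>S. \<tau> (f x))" for f :: "'b \<Rightarrow> _" and S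
    by (induction S rule: infinite_finite_induct) (simp_all add: zero add)
  fix i :: 'n
  define t where "t = \<tau> (matrix_unit i i)"
  have unit: "\<tau> (matrix_unit r s) = (if r = s then t else 0)" for r s
    using comm[of "matrix_unit r i" "matrix_unit i s"] by (auto simp: matrix_unit_mult zero t_def)
  have *: "\<tau> M = trace M * t" for M
  proof -
    have "\<tau> M = (\<Sum>r\<in>UNIV. \<Sum>s\<in>UNIV. M $ r $ s * \<tau> (matrix_unit r s))"
      by (subst matrix_eq_sum_matrix_units) (simp only: sum scale)
    also have "\<dots> = (\<Sum>r\<in>UNIV. \<Sum>s\<in>UNIV. if s = r then M $ r $ r * t else 0)"
      by (intro sum.cong refl) (simp add: unit)
    also have "\<dots> = trace M * t"
      by (simp add: trace_def sum_distrib_right)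
    finally show ?thesis .
  qed
  show ?thesis
    using *[of "mat 1"] *[of M] by (simp add: trace_I)
qed

lemma trace_scale: "trace (scale_matrix c M) = c * trace M"
  by (simp add: trace_def sum_distrib_left)

text \<open>
  The functional \<open>M \<mapsto> trace M\<^sub>0\<close> is itself tracial, because
  \<open>(M N)\<^sub>0 = \<Sum>\<^sub>g M\<^sub>g N\<^sub>-\<^sub>g\<close> is symmetric up to commutators. Characteristic zero
  is what allows \<open>CARD('n)\<close> to be cancelled.
\<close>

lemma trace_component_zero:
  fixes \<Gamma> :: "'g::{finite,ab_group_add} \<Rightarrow> ('k::field_char_0^'n^'n) set"
  assumes \<Gamma>: "matrix_algebra.grading \<Gamma>"
  shows "trace (matrix_algebra.component \<Gamma> M 0) = trace M"
proof -
  let ?c = "matrix_algebra.component \<Gamma>"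
  let ?\<tau> = "\<lambda>M. trace (?c M 0)"
  have "?\<tau> (M ** N) = ?\<tau> (N ** M)" for M N
  proof -
    have tr_sum: "trace (sum f S) = (\<Sum>x\<in>S. trace (f x))" for f :: "'g \<Rightarrow> 'k^'n^'n" and S
      by (induction S rule: infinite_finite_induct) (simp_all add: trace_add trace_0[simplified])
    have "?\<tau> (M ** N) = (\<Sum>g\<in>UNIV. trace (?c M g ** ?c N (- g)))"
      by (simp add: matrix_algebra.component_mult[OF \<Gamma>] tr_sum)
    also have "\<dots> = (\<Sum>g\<in>UNIV. trace (?c N g ** ?c M (- g)))"
      by (intro sum.reindex_bij_witness[of _ uminus uminus]) (simp_all, rule trace_mul_sym)
    also have "\<dots> = ?\<tau> (N ** M)"
      by (simp add: matrix_algebra.component_mult[OF \<Gamma>] tr_sum)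
    finally show ?thesis .
  qed
  then have "of_nat CARD('n) * ?\<tau> M = trace M * ?\<tau> (mat 1)"
    by (intro tracial_functional_eq_trace)
      (simp_all add: matrix_algebra.component_add[OF \<Gamma>] matrix_algebra.component_scale[OF \<Gamma>]
        trace_add trace_scale)
  moreover have "?\<tau> (mat 1) = of_nat CARD('n)"
    by (simp add: matrix_algebra.component_homogeneous[OF \<Gamma> matrix_algebra.one_mem_degree_zero[OF \<Gamma>]] trace_I)
  ultimately show ?thesis by simp
qed

text \<open>
  The trace form is non-degenerate on all matrices and only sees total degree zero, so it pairs
  \<open>\<Gamma> g\<close> with \<open>\<Gamma> (- g)\<close> without degeneracy. This stands in for the semisimplicity of the
  degree-zero part.
\<close>

lemma ex_homogeneous_trace_ne_zero:
  fixes \<Gamma> :: "'g::{finite,ab_group_add} \<Rightarrow> ('k::field_char_0^'n^'n) set"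
  assumes \<Gamma>: "matrix_algebra.grading \<Gamma>" and M: "M \<in> \<Gamma> g" "M \<noteq> 0"
  shows "\<exists>N\<in>\<Gamma> (- g). trace (M ** N) \<noteq> 0"
proof -
  obtain i j where ij: "M $ i $ j \<noteq> 0"
    using M by (auto simp: vec_eq_iff)
  let ?N = "matrix_unit j i :: 'k^'n^'n"
  have "trace (M ** ?N) = M $ i $ j"
    by (simp add: trace_def matrix_mult_matrix_unit_nth)
  moreover have "matrix_algebra.component \<Gamma> (M ** ?N) 0 = M ** matrix_algebra.component \<Gamma> ?N (- g)"
  proof -
    have "matrix_algebra.component \<Gamma> (M ** ?N) 0
        = (\<Sum>h\<in>UNIV. if h = g then M ** matrix_algebra.component \<Gamma> ?N (- h) else 0)"
      unfolding matrix_algebra.component_mult[OF \<Gamma>]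
      by (intro sum.cong) (auto simp: matrix_algebra.component_homogeneous[OF \<Gamma> M(1)])
    then show ?thesis by simp
  qed
  ultimately show ?thesis
    using ij trace_component_zero[OF \<Gamma>, of "M ** ?N"] matrix_algebra.component_mem[OF \<Gamma>] by metis
qed

section \<open>Gradings with scalar degree-zero part\<close>

text \<open>
  Here the trace pairing makes every nonzero homogeneous element \<open>X\<close> invertible with homogeneous
  inverse, so that each nonzero component is a line. Then a variable of degree \<open>g\<close> and a variable of degree
  \<open>- g\<close> already take values in inverse lines. The Pauli gradings are of this kind.
\<close>

lemma not_primeness_property_if_degree_zero_scalar:
  fixes \<Gamma> :: "'g::{finite,ab_group_add} \<Rightarrow> ('k::field_char_0^'n^'n) set"
  assumes \<Gamma>: "matrix_algebra.grading \<Gamma>" and nontriv: "\<not> matrix_algebra.trivial_grading \<Gamma>"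
    and scalar: "\<And>M. M \<in> \<Gamma> 0 \<Longrightarrow> \<exists>c. M = scale_matrix c (mat 1)"
  shows "\<not> matrix_algebra.primeness_property \<Gamma>"
proof -
  note sub = matrix_algebra.grading_subspace[OF \<Gamma>]
  note zero = matrix_algebra.subspace_0[OF sub]
  obtain g where g: "g \<noteq> 0" "\<Gamma> g \<noteq> {0}"
    using nontriv by (auto simp: matrix_algebra.trivial_grading_def)
  then obtain X where X: "X \<in> \<Gamma> g" "X \<noteq> 0"
    using zero[of g] by blast
  then obtain N where N: "N \<in> \<Gamma> (- g)" "trace (X ** N) \<noteq> 0"
    using ex_homogeneous_trace_ne_zero[OF \<Gamma>] by blast
  obtain c where c: "X ** N = scale_matrix c (mat 1)"
    using scalar matrix_algebra.grading_mult[OF \<Gamma> X(1) N(1)] by fastforce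
  have c0: "c \<noteq> 0"
    using N c by (auto simp: trace_def)
  define Y where "Y = scale_matrix (inverse c) N"
  have Y: "Y \<in> \<Gamma> (- g)"
    unfolding Y_def by (intro matrix_algebra.subspace_scale[OF sub] N)
  have XY: "X ** Y = mat 1"
    using c c0 by (simp add: Y_def matrix_algebra.mult_scale_right)
  then have YX: "Y ** X = mat 1"
    by (simp add: matrix_left_right_inverse)
  have Y_ne_0: "Y \<noteq> 0"
    using arg_cong[OF XY, of "\<lambda>M. M ** X"] X by auto
  have f: "\<exists>c. Z = scale_matrix c X" if Z: "Z \<in> \<Gamma> g" for Z
  proof -
    obtain c where "Z ** Y = scale_matrix c (mat 1)"
      using scalar matrix_algebra.grading_mult[OF \<Gamma> Z Y] by fastforce
    then have "Z ** Y ** X = scale_matrix c X"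
      by (simp add: matrix_algebra.mult_scale_left)
    then show ?thesis
      using YX by (auto simp flip: matrix_mul_assoc)
  qed
  have h: "\<exists>c. Z = scale_matrix c Y" if Z: "Z \<in> \<Gamma> (- g)" for Z
  proof -
    obtain c where "Z ** X = scale_matrix c (mat 1)"
      using scalar matrix_algebra.grading_mult[OF \<Gamma> Z X(1)] by fastforce
    then have "Z ** X ** Y = scale_matrix c Y"
      by (simp add: matrix_algebra.mult_scale_left)
    then show ?thesis
      using XY by (auto simp flip: matrix_mul_assoc)
  qed
  have X_noncentral: "X \<notin> matrix_algebra.centre"
  proof
    assume "X \<in> matrix_algebra.centre"
    from centre_matrix_algebra[OF this] have "X \<in> \<Gamma> 0"
      using matrix_algebra.subspace_scale[OF sub matrix_algebra.one_mem_degree_zero[OF \<Gamma>]] by metis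
    then show False
      using X g fun_cong[OF matrix_algebra.component_homogeneous[OF \<Gamma> X(1)], of 0]
        fun_cong[OF matrix_algebra.component_homogeneous[OF \<Gamma> \<open>X \<in> \<Gamma> 0\<close>], of 0] by auto
  qed
  define s where "s x = (if fst x = g then X else 0)" for x :: "'g \<times> nat"
  define t where "t x = (if fst x = - g then Y else 0)" for x :: "'g \<times> nat"
  show ?thesis
  proof (rule matrix_algebra.not_primeness_property_if_values_inverse_lines[OF XY X_noncentral])
    show "vars (variable (g, 0) :: ('k, 'g) graded_poly) \<inter> vars (variable (- g, 1) :: ('k, 'g) graded_poly) = {}"
      by (simp add: vars_variable)
    show "matrix_algebra.graded_subst \<Gamma> s" "matrix_algebra.graded_subst \<Gamma> t"
      using X Y zero by (auto simp: s_def t_def matrix_algebra.graded_subst_def)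
    show "matrix_algebra.eval_poly s (variable (g, 0)) \<noteq> 0"
      using X by (simp add: matrix_algebra.eval_poly_variable s_def)
    show "matrix_algebra.eval_poly t (variable (- g, 1)) \<noteq> 0"
      using Y_ne_0 by (simp add: matrix_algebra.eval_poly_variable t_def)
  qed (use f h in \<open>auto simp: matrix_algebra.eval_poly_variable matrix_algebra.graded_subst_def\<close>)
qed

section \<open>Rank-one elements of degree zero\<close>

definition rank_one_matrix :: "'k::field^'n \<Rightarrow> 'k^'n \<Rightarrow> 'k^'n^'n"
  where "rank_one_matrix v w = (\<chi> i j. v $ i * w $ j)"

lemma rank_one_matrix_nth [simp]: "rank_one_matrix v w $ i $ j = v $ i * w $ j"
  by (simp add: rank_one_matrix_def)

lemma matrix_mult_rank_one: "M ** rank_one_matrix v w = rank_one_matrix (M *v v) w"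
  by (simp add: vec_eq_iff matrix_matrix_mult_nth matrix_vector_mult_def sum_distrib_right mult.assoc)

lemma rank_one_matrix_mult: "rank_one_matrix v w ** M = rank_one_matrix v (w v* M)"
  by (simp add: vec_eq_iff matrix_matrix_mult_nth vector_matrix_mult_def sum_distrib_left mult_ac)

lemma rank_one_matrix_mult_vec: "rank_one_matrix v w *v x = (\<Sum>i\<in>UNIV. w $ i * x $ i) *s v"
  by (simp add: vec_eq_iff matrix_vector_mult_def vector_scalar_mult_def sum_distrib_left
      sum_distrib_right mult_ac)

text \<open>
  The criterion by which both cases of the next lemma recognise a matrix of rank at most one.
\<close>

lemma rank_one_if_columns_in_line:
  fixes M :: "'k::field^'n^'n"
  assumes "\<And>j. \<exists>c. column j M = c *s v"
  shows "\<exists>w. M = rank_one_matrix v w"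
proof -
  obtain c where c: "column j M = c j *s v" for j
    using assms by metis
  have "M = rank_one_matrix v (\<chi> j. c j)"
    using c by (simp add: vec_eq_iff column_def mult.commute)
  then show ?thesis ..
qed

text \<open>
  The ranks of \<open>B\<close> and \<open>C\<close> add up to at most three. Concretely, if the columns of \<open>C\<close>
  do not all lie on one line, then two of them span a plane in the kernel of \<open>B\<close>, which at most one
  further vector \<open>z\<close> completes to the whole space, so the image of \<open>B\<close> is spanned by \<open>B *v z\<close>.
\<close>

lemma ex_rank_one_if_mult_eq_zero:
  fixes B C :: "'k::field^'n^'n"
  assumes card: "CARD('n) \<le> 3" and BC: "B ** C = 0" and C: "C \<noteq> 0"
  shows "(\<exists>v w. B = rank_one_matrix v w) \<or> (\<exists>v w. C = rank_one_matrix v w)"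
proof -
  obtain l where l: "column l C \<noteq> 0"
    using C by (auto simp: vec_eq_iff column_def)
  show ?thesis
  proof (cases "\<forall>j. column j C \<in> vec.span {column l C}")
    case True
    then have "\<exists>w. C = rank_one_matrix (column l C) w"
      by (intro rank_one_if_columns_in_line) (auto simp: vec.span_singleton)
    then show ?thesis by blast
  next
    case False
    then obtain j where j: "column j C \<notin> vec.span {column l C}" by blast
    let ?S = "{column j C, column l C}"
    have indep: "vec.independent ?S"
      using j l by (intro vec.independent_insertI) (use vec.independent_empty in auto)
    have "column j C \<noteq> column l C"
      using j vec.span_base by fastforce
    then have card_S: "card ?S = 2" by simp
    define E where "E = vec.extend_basis ?S"
    have E: "vec.independent E" "vec.span E = UNIV" "?S \<subseteq> E"
      unfolding E_def
      by (rule vec.independent_extend_basis[OF indep] vec.span_extend_basis[OF indep]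
          vec.extend_basis_superset[OF indep])+
    have "card E = CARD('n)"
      using vec.dim_eq_card_independent[OF E(1)] vec.dim_span[of E] E(2) vec_dim_card
      by metis
    have "card (E - ?S) \<le> 1"
      using card card_S \<open>card E = CARD('n)\<close> E(3) by (simp add: card_Diff_subset)
    moreover have "finite (E - ?S)"
      using vec.finiteI_independent[OF E(1)] by simp
    ultimately obtain z where z: "E - ?S \<subseteq> {z}"
      by (metis card_le_Suc0_iff_eq One_nat_def insertI1 subsetI singletonD empty_subsetI ex_in_conv singletonI)
    have ker: "B *v x = 0" if "x \<in> vec.span ?S" for x
    proof -
      have "B *v column i C = column i (B ** C)" for i
        by (simp add: vec_eq_iff column_def matrix_vector_mult_def matrix_matrix_mult_nth)
      then have "B *v column i C = 0" for i
        using BC by (simp add: column_def vec_eq_iff)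
      then show ?thesis
        by (intro vec.linear_eq_0_on_span[OF matrix_vector_mul_linear_gen _ that]) auto
    qed
    have line: "\<exists>c. B *v x = c *s (B *v z)" for x
    proof -
      have "E \<subseteq> insert z ?S"
        using z by blast
      then have "x \<in> vec.span (insert z ?S)"
        using vec.span_mono[of E "insert z ?S"] E(2) by blast
      then obtain c where "x - c *s z \<in> vec.span ?S"
        unfolding vec.span_insert[of z] by blast
      then have "B *v (x - c *s z) = 0"
        by (rule ker)
      then show ?thesis
        by (metis matrix_vector_mult_diff_distrib vec.scale eq_iff_diff_eq_0 vector_smult_assoc
            matrix_vector_mul_linear_gen)
    qed
    have "column i B = B *v axis i 1" for i
      by (simp add: vec_eq_iff column_def matrix_vector_mult_def axis_def if_distrib cong: if_cong)
    then have "\<exists>w. B = rank_one_matrix (B *v z) w"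
      using line by (intro rank_one_if_columns_in_line) simp
    then show ?thesis by blast
  qed
qed

text \<open>
  A product \<open>v w\<^sup>T N\<close> of nonzero trace \<open>t\<close> has the form \<open>v u\<^sup>T\<close> and squares to \<open>t\<close> times
  itself. Dividing by \<open>t\<close> gives an idempotent, whence the condition on the sum.
\<close>

lemma ex_rank_one_idempotent_degree_zero:
  fixes \<Gamma> :: "'g::{finite,ab_group_add} \<Rightarrow> ('k::{alg_closed_field,field_char_0}^'n^'n) set"
  assumes \<Gamma>: "matrix_algebra.grading \<Gamma>" and card: "CARD('n) \<le> 3"
    and M: "M \<in> \<Gamma> 0" "\<And>c. M \<noteq> scale_matrix c (mat 1)"
  shows "\<exists>v w. rank_one_matrix v w \<in> \<Gamma> 0 \<and> (\<Sum>i\<in>UNIV. w $ i * v $ i) = 1"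
proof -
  note sub = matrix_algebra.grading_subspace[OF \<Gamma>]
  have mult: "X ** Y \<in> \<Gamma> 0" if "X \<in> \<Gamma> 0" "Y \<in> \<Gamma> 0" for X Y
    using matrix_algebra.grading_mult[OF \<Gamma> that] by simp
  have fin: "finite (range (\<lambda>(i, j). matrix_unit i j :: 'k^'n^'n))"
    by simp
  obtain B C where BC: "B \<in> \<Gamma> 0" "C \<in> \<Gamma> 0" "B \<noteq> 0" "C \<noteq> 0" "B ** C = 0"
    using ex_zero_divisors_if_not_scalar[OF matrix_algebra.unital_algebra_axioms fin
        span_matrix_units sub matrix_algebra.one_mem_degree_zero[OF \<Gamma>] mult M] by blast
  obtain v w where vw: "rank_one_matrix v w \<in> \<Gamma> 0" "rank_one_matrix v w \<noteq> 0"
    using ex_rank_one_if_mult_eq_zero[OF card BC(5,4)] BC by blast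
  then obtain N where N: "N \<in> \<Gamma> (- 0)" "trace (rank_one_matrix v w ** N) \<noteq> 0"
    using ex_homogeneous_trace_ne_zero[OF \<Gamma>] by blast
  define t where "t = trace (rank_one_matrix v w ** N)"
  define u where "u = inverse t *s (w v* N)"
  have "rank_one_matrix v u = scale_matrix (inverse t) (rank_one_matrix v w ** N)"
    by (simp add: rank_one_matrix_mult u_def vec_eq_iff)
  then have "rank_one_matrix v u \<in> \<Gamma> 0"
    using mult[OF vw(1)] N(1) matrix_algebra.subspace_scale[OF sub] by simp
  moreover have "(\<Sum>i\<in>UNIV. u $ i * v $ i) = inverse t * t"
    unfolding t_def[unfolded rank_one_matrix_mult trace_def rank_one_matrix_nth] sum_distrib_left
    by (simp add: u_def t_def rank_one_matrix_mult trace_def mult_ac)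
  ultimately show ?thesis
    using N(2) by (auto simp: t_def)
qed

section \<open>Homogeneous coordinates\<close>

text \<open>
  One inclusion for all degrees at once forces equality: the supports that belong to distinct degrees are
  disjoint, so no cancellation can occur between the components of \<open>M\<close>.
\<close>

lemma mem_degree_iff_entry_degrees:
  fixes \<Gamma> :: "'g::{finite,ab_group_add} \<Rightarrow> ('k::field^'n^'n) set" and d :: "'n \<Rightarrow> 'g"
  assumes \<Gamma>: "matrix_algebra.grading \<Gamma>" and PQ: "P ** Q = mat 1" "Q ** P = mat 1"
    and support: "\<And>g M i j. M \<in> \<Gamma> g \<Longrightarrow> (Q ** M ** P) $ i $ j \<noteq> 0 \<Longrightarrow> d i - d j = g"
  shows "M \<in> \<Gamma> g \<longleftrightarrow> (\<forall>i j. (Q ** M ** P) $ i $ j \<noteq> 0 \<longrightarrow> d i - d j = g)"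
proof
  assume M: "\<forall>i j. (Q ** M ** P) $ i $ j \<noteq> 0 \<longrightarrow> d i - d j = g"
  let ?c = "matrix_algebra.component \<Gamma> M"
  note mem = matrix_algebra.component_mem[OF \<Gamma>, of M]
  have "?c h = 0" if "h \<noteq> g" for h
  proof -
    have "(Q ** ?c h ** P) $ i $ j = 0" for i j
    proof (cases "d i - d j = h")
      case True
      have "Q ** M ** P = (\<Sum>k\<in>UNIV. Q ** ?c k ** P)"
        using matrix_algebra.sum_component[OF \<Gamma>, of M]
        by (metis (no_types) matrix_algebra.mult_sum_left matrix_algebra.mult_sum_right)
      then have "(Q ** M ** P) $ i $ j = (\<Sum>k\<in>UNIV. (Q ** ?c k ** P) $ i $ j)"
        by (simp add: sum_component)
      also have "\<dots> = (\<Sum>k\<in>UNIV. if k = h then (Q ** ?c h ** P) $ i $ j else 0)"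
        using support[OF mem] True by (intro sum.cong) auto
      finally have "(Q ** M ** P) $ i $ j = (Q ** ?c h ** P) $ i $ j"
        by simp
      then show ?thesis
        using M True that by metis
    next
      case False
      then show ?thesis
        using support[OF mem] by blast
    qed
    then have "Q ** ?c h ** P = 0"
      by (simp add: vec_eq_iff)
    then have "P ** (Q ** ?c h ** P) ** Q = 0"
      by simp
    then show ?thesis
      using PQ(1) by (metis matrix_mul_assoc matrix_mul_lid matrix_mul_rid)
  qed
  then have "(\<Sum>h\<in>UNIV. ?c h) = (\<Sum>h\<in>UNIV. if h = g then ?c g else 0)"
    by (intro sum.cong) auto
  then have "M = ?c g"
    by (simp add: matrix_algebra.sum_component[OF \<Gamma>])
  then show "M \<in> \<Gamma> g"
    using mem by metis
qed (use support in blast)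

text \<open>
  For the idempotent \<open>e = v w\<^sup>T\<close> the left ideal of all \<open>M ** e\<close> is a copy of the column space,
  through \<open>x \<mapsto> x w\<^sup>T\<close>. It is a sum of homogeneous pieces since \<open>e\<close> has degree zero, which grades the
  column space compatibly with the action of matrices. The columns of \<open>P\<close> are a homogeneous
  basis, and \<open>d\<close> records its degrees.
\<close>

lemma ex_homogeneous_coordinates:
  fixes \<Gamma> :: "'g::{finite,ab_group_add} \<Rightarrow> ('k::field^'n^'n) set"
  assumes \<Gamma>: "matrix_algebra.grading \<Gamma>"
    and e: "rank_one_matrix v w \<in> \<Gamma> 0" "(\<Sum>i\<in>UNIV. w $ i * v $ i) = 1"
  shows "\<exists>P Q (d :: 'n \<Rightarrow> 'g). P ** Q = mat 1 \<and> Q ** P = mat 1 \<and>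
    (\<forall>g M. M \<in> \<Gamma> g \<longleftrightarrow> (\<forall>i j. (Q ** M ** P) $ i $ j \<noteq> 0 \<longrightarrow> d i - d j = g))"
proof -
  note sub = matrix_algebra.grading_subspace[OF \<Gamma>]
  define V where "V g = {x. rank_one_matrix x w \<in> \<Gamma> g}" for g
  have w: "w \<noteq> 0" using e(2) by auto
  have rank_one_eq_0: "x = 0" if "rank_one_matrix x w = 0" for x
    using that w by (auto simp: vec_eq_iff)
  have "x \<in> vec.span (\<Union>g. V g)" for x
  proof -
    let ?c = "matrix_algebra.component \<Gamma> (rank_one_matrix x w)"
    have "?c g *v v \<in> V g" for g
      using matrix_algebra.grading_mult[OF \<Gamma> matrix_algebra.component_mem[OF \<Gamma>, of "rank_one_matrix x w" g] e(1)]
      by (simp add: V_def matrix_mult_rank_one)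
    then have "(\<Sum>g\<in>UNIV. ?c g *v v) \<in> vec.span (\<Union>g. V g)"
      by (intro vec.span_sum vec.span_base) blast
    also have "(\<Sum>g\<in>UNIV. ?c g *v v) = (\<Sum>g\<in>UNIV. ?c g) *v v"
      by (simp add: vec_eq_iff matrix_vector_mult_def sum_component sum_distrib_right)
        (intro allI, rule sum.swap)
    also have "\<dots> = x"
      by (simp add: matrix_algebra.sum_component[OF \<Gamma>] rank_one_matrix_mult_vec e(2))
    finally show ?thesis .
  qed
  then have span_V: "vec.span (\<Union>g. V g) = UNIV" by blast
  obtain B where B: "B \<subseteq> (\<Union>g. V g)" "vec.independent B" "(\<Union>g. V g) \<subseteq> vec.span B"
    using vec.maximal_independent_subset by blast
  have span_B: "vec.span B = UNIV"
    using span_V vec.span_minimal[OF B(3) vec.subspace_span] by blast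
  have "card B = CARD('n)"
    using vec.dim_eq_card_independent[OF B(2)] vec.dim_span[of B] span_B vec_dim_card by metis
  moreover have "finite B"
    using vec.finiteI_independent[OF B(2)] .
  ultimately obtain b :: "'n \<Rightarrow> 'k^'n" where b: "bij_betw b UNIV B"
    using finite_same_card_bij[of "UNIV :: 'n set" B] by auto
  have "\<exists>g. b i \<in> V g" for i
    using b B(1) by (auto simp: bij_betw_def)
  then obtain d where d: "b i \<in> V (d i)" for i
    by metis
  define P :: "'k^'n^'n" where "P = (\<chi> r i. b i $ r)"
  have "columns P = B"
    using b by (auto simp: columns_def column_def P_def bij_betw_def)
  then obtain Q where PQ: "P ** Q = mat 1"
    using matrix_right_invertible_span_columns[of P] span_B by auto
  then have QP: "Q ** P = mat 1"
    by (simp add: matrix_left_right_inverse)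
  have P_mult: "P *v x = (\<Sum>i\<in>UNIV. x $ i *s b i)" for x
    by (simp add: vec_eq_iff matrix_vector_mult_def P_def sum_component mult.commute)
  have support: "d i - d j = g" if M: "M \<in> \<Gamma> g" and ij: "(Q ** M ** P) $ i $ j \<noteq> 0" for g M i j
  proof (rule ccontr)
    assume ne: "d i - d j \<noteq> g"
    define x where "x = column j (Q ** M ** P)"
    let ?R = "\<lambda>x. rank_one_matrix x w"
    have "P *v x = M *v b j"
    proof -
      have "P ** (Q ** M ** P) = M ** P"
        using PQ by (simp add: matrix_mul_assoc)
      then have "column j (P ** (Q ** M ** P)) = column j (M ** P)"
        by simp
      then show ?thesis
        by (simp add: vec_eq_iff column_def x_def P_def matrix_vector_mult_def matrix_matrix_mult_nth)
    qed
    then have "?R (P *v x) = M ** ?R (b j)"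
      by (simp add: matrix_mult_rank_one)
    also have "\<dots> \<in> \<Gamma> (g + d j)"
      using matrix_algebra.grading_mult[OF \<Gamma> M] d by (simp add: V_def)
    finally have mem: "?R (P *v x) \<in> \<Gamma> (g + d j)" .
    have "?R (P *v x) = (\<Sum>k\<in>UNIV. scale_matrix (x $ k) (?R (b k)))"
      by (simp add: vec_eq_iff P_mult sum_component sum_distrib_left sum_distrib_right mult_ac)
    moreover have "matrix_algebra.component \<Gamma> (scale_matrix (x $ k) (?R (b k))) (d i)
        = (if d k = d i then scale_matrix (x $ k) (?R (b k)) else 0)" for k
    proof -
      have "scale_matrix (x $ k) (?R (b k)) \<in> \<Gamma> (d k)"
        using d by (intro matrix_algebra.subspace_scale[OF sub]) (simp add: V_def)
      then show ?thesis
        by (simp add: matrix_algebra.component_homogeneous[OF \<Gamma>])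
    qed
    ultimately have "matrix_algebra.component \<Gamma> (?R (P *v x)) (d i)
        = (\<Sum>k\<in>UNIV. if d k = d i then scale_matrix (x $ k) (?R (b k)) else 0)"
      by (simp add: matrix_algebra.component_sum[OF \<Gamma>])
    moreover have "matrix_algebra.component \<Gamma> (?R (P *v x)) (d i) = 0"
      using ne by (auto simp: matrix_algebra.component_homogeneous[OF \<Gamma> mem])
    \<comment> \<open>The part of \<open>x\<close> in degree \<open>d i\<close>, which vanishes because \<open>P *v x\<close> is homogeneous of degree
      \<open>g + d j\<close>.\<close>
    moreover define y where "y = (\<chi> k. if d k = d i then x $ k else 0)"
    have "?R (P *v y) = (\<Sum>k\<in>UNIV. if d k = d i then scale_matrix (x $ k) (?R (b k)) else 0)"
      by (simp add: vec_eq_iff P_mult sum_component sum_distrib_left sum_distrib_right mult_ac y_def)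
        (intro allI sum.cong, auto)
    ultimately have "P *v y = 0"
      using rank_one_eq_0 by metis
    then have "y = 0"
      using QP by (metis matrix_vector_mul_assoc matrix_vector_mul_lid matrix_vector_mult_0_right)
    then have "y $ i = 0" by simp
    then show False
      using ij by (simp add: y_def x_def column_def)
  qed
  show ?thesis
    by (rule exI[of _ P], rule exI[of _ Q], rule exI[of _ d])
      (intro conjI allI PQ QP mem_degree_iff_entry_degrees[OF \<Gamma> PQ QP support])
qed

section \<open>Elementary gradings\<close>

definition diagonal_matrix :: "('n \<Rightarrow> 'k::field) \<Rightarrow> 'k^'n^'n"
  where "diagonal_matrix x = (\<chi> i j. if i = j then x i else 0)"

lemma diagonal_matrix_nth [simp]: "diagonal_matrix x $ i $ j = (if i = j then x i else 0)"
  by (simp add: diagonal_matrix_def)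

lemma diagonal_matrix_mult:
  "diagonal_matrix x ** diagonal_matrix y = diagonal_matrix (\<lambda>i. x i * y i)"
proof -
  have "(diagonal_matrix x ** diagonal_matrix y) $ i $ j = (\<Sum>k\<in>UNIV. if k = i then if i = j then x i * y i else 0 else 0)" for i j
    unfolding matrix_matrix_mult_nth by (intro sum.cong) auto
  then show ?thesis by (simp add: vec_eq_iff)
qed

text \<open>
  After the change of basis \<open>P\<close>, the matrix unit at \<open>(i, j)\<close> is homogeneous of degree \<open>d i - d j\<close>.
\<close>

locale elementary_grading =
  fixes \<Gamma> :: "'g::{finite,ab_group_add} \<Rightarrow> ('k::field^'n^'n) set"
    and P Q :: "'k^'n^'n" and d :: "'n \<Rightarrow> 'g"
  assumes grading: "matrix_algebra.grading \<Gamma>"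
    and PQ: "P ** Q = mat 1" and QP: "Q ** P = mat 1"
    and mem_iff: "M \<in> \<Gamma> g \<longleftrightarrow> (\<forall>i j. (Q ** M ** P) $ i $ j \<noteq> 0 \<longrightarrow> d i - d j = g)"
begin

definition coords :: "'k^'n^'n \<Rightarrow> 'k^'n^'n"
  where "coords M = Q ** M ** P"

definition of_coords :: "'k^'n^'n \<Rightarrow> 'k^'n^'n"
  where "of_coords M = P ** M ** Q"

lemma coords_of_coords [simp]: "coords (of_coords M) = M"
proof -
  have "coords (of_coords M) = (Q ** P) ** M ** (Q ** P)"
    by (simp only: coords_def of_coords_def matrix_mul_assoc)
  then show ?thesis by (simp add: QP)
qed

lemma of_coords_coords [simp]: "of_coords (coords M) = M"
proof -
  have "of_coords (coords M) = (P ** Q) ** M ** (P ** Q)"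
    by (simp only: coords_def of_coords_def matrix_mul_assoc)
  then show ?thesis by (simp add: PQ)
qed

lemma coords_mult: "coords (M ** N) = coords M ** coords N"
proof -
  have "coords M ** coords N = Q ** M ** (P ** Q) ** N ** P"
    by (simp only: coords_def matrix_mul_assoc)
  then show ?thesis by (simp add: PQ coords_def matrix_mul_assoc)
qed

lemma coords_one [simp]: "coords (mat 1) = mat 1"
  by (simp add: coords_def QP)

lemma coords_add: "coords (M + N) = coords M + coords N"
  by (simp add: coords_def matrix_algebra.mult_add_left matrix_algebra.mult_add_right)

lemma coords_scale: "coords (scale_matrix c M) = scale_matrix c (coords M)"
  by (simp add: coords_def matrix_algebra.mult_scale_left matrix_algebra.mult_scale_right)

lemma coords_diff: "coords (M - N) = coords M - coords N"
  using coords_add[of "M - N" N] by simp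

lemma coords_eq_iff: "coords M = coords N \<longleftrightarrow> M = N"
  by (metis of_coords_coords)

lemmas coords_simps = coords_mult coords_add coords_diff coords_scale

lemma coords_nth_eq_0: "M \<in> \<Gamma> g \<Longrightarrow> d i - d j \<noteq> g \<Longrightarrow> coords M $ i $ j = 0"
  by (auto simp: mem_iff coords_def)

lemma of_coords_matrix_unit_mem: "of_coords (matrix_unit i j) \<in> \<Gamma> (d i - d j)"
  unfolding mem_iff coords_def[symmetric] by simp

lemma zero_mem: "0 \<in> \<Gamma> g"
  using matrix_algebra.subspace_0[OF matrix_algebra.grading_subspace[OF grading]] .

lemma degree_not_constant:
  assumes "\<not> matrix_algebra.trivial_grading \<Gamma>"
  shows "\<exists>i j. d i \<noteq> d j"
proof (rule ccontr)
  assume *: "\<nexists>i j. d i \<noteq> d j"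
  have "M = 0" if "M \<in> \<Gamma> g" "g \<noteq> 0" for M g
  proof -
    have "coords M $ i $ j = 0" for i j
      using * coords_nth_eq_0[OF that(1)] that(2) by (metis diff_self)
    then have "coords M = coords 0"
      by (simp add: vec_eq_iff coords_def)
    then show ?thesis
      by (simp add: coords_eq_iff)
  qed
  then have "matrix_algebra.trivial_grading \<Gamma>"
    using zero_mem by (auto simp: matrix_algebra.trivial_grading_def)
  with assms show False ..
qed

text \<open>
  Conjugation by diagonal matrices in these coordinates preserves the grading, hence the set of values
  of every polynomial. Over an infinite field an invertible matrix whose multiples include all
  values of a non-identity is therefore diagonal, so inverse lines arise in this form.
\<close>

lemma not_primeness_property_if_diagonal_values:
  fixes f g :: "('k, 'g) graded_poly"
  assumes xy: "\<And>i. x i * y i = 1" and x: "x i0 \<noteq> x j0"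
    and disj: "vars f \<inter> vars g = {}"
    and f: "\<And>s. matrix_algebra.graded_subst \<Gamma> s \<Longrightarrow>
      \<exists>c. coords (matrix_algebra.eval_poly s f) = scale_matrix c (diagonal_matrix x)"
    and g: "\<And>s. matrix_algebra.graded_subst \<Gamma> s \<Longrightarrow>
      \<exists>c. coords (matrix_algebra.eval_poly s g) = scale_matrix c (diagonal_matrix y)"
    and s: "matrix_algebra.graded_subst \<Gamma> s" "matrix_algebra.eval_poly s f \<noteq> 0"
    and t: "matrix_algebra.graded_subst \<Gamma> t" "matrix_algebra.eval_poly t g \<noteq> 0"
  shows "\<not> matrix_algebra.primeness_property \<Gamma>"
proof (rule matrix_algebra.not_primeness_property_if_values_inverse_lines[OF _ _ disj _ _ s t])
  let ?X = "of_coords (diagonal_matrix x)" and ?Y = "of_coords (diagonal_matrix y)"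
  have "coords (?X ** ?Y) = coords (mat 1)"
    by (simp add: coords_mult diagonal_matrix_mult xy) (simp add: vec_eq_iff mat_1_nth)
  then show "?X ** ?Y = mat 1"
    by (simp only: coords_eq_iff)
  show "?X \<notin> matrix_algebra.centre"
  proof
    assume "?X \<in> matrix_algebra.centre"
    from centre_matrix_algebra[OF this] obtain c where c: "?X = scale_matrix c (mat 1)"
      by blast
    have "diagonal_matrix x = scale_matrix c (mat 1)"
      using arg_cong[OF c, of coords] by (simp add: coords_scale)
    from arg_cong[OF this, of "\<lambda>M. M $ i $ i" for i] have "x i = c" for i
      by (simp add: mat_1_nth)
    with x show False by simp
  qed
  show "\<exists>c. matrix_algebra.eval_poly s f = scale_matrix c ?X"
    if u: "matrix_algebra.graded_subst \<Gamma> s" for s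
  proof -
    obtain c where "coords (matrix_algebra.eval_poly s f) = coords (scale_matrix c ?X)"
      using f[OF u] by (auto simp: coords_scale)
    then show ?thesis
      unfolding coords_eq_iff ..
  qed
  show "\<exists>c. matrix_algebra.eval_poly s g = scale_matrix c ?Y"
    if u: "matrix_algebra.graded_subst \<Gamma> s" for s
  proof -
    obtain c where "coords (matrix_algebra.eval_poly s g) = coords (scale_matrix c ?Y)"
      using g[OF u] by (auto simp: coords_scale)
    then show ?thesis
      unfolding coords_eq_iff ..
  qed
qed

lemma graded_substD:
  "matrix_algebra.graded_subst \<Gamma> s \<Longrightarrow> s (g, n) \<in> \<Gamma> g"
  by (simp add: matrix_algebra.graded_subst_def)

end

section \<open>Polynomials for elementary gradings\<close>

definition commutator_poly :: "'g::ab_group_add \<Rightarrow> nat \<Rightarrow> ('k::field, 'g) graded_poly"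
  where "commutator_poly h n =
    variable (h, n) * variable (- h, Suc n) - variable (- h, Suc n) * variable (h, n)"

lemma vars_commutator_poly:
  "vars (commutator_poly h n :: ('k::field, 'g::ab_group_add) graded_poly) \<subseteq> UNIV \<times> {n..<n + 2}"
  unfolding commutator_poly_def by (intro vars_subset_intros) (auto simp: vars_variable)

text \<open>
  Elements of degree \<open>h\<close> and \<open>- h\<close> have zero diagonal. Their commutator is diagonal of trace zero,
  even if \<open>h = - h\<close>, hence a multiple of \<open>diag(1, -1)\<close>, which is its own inverse.
\<close>

lemma (in elementary_grading) not_primeness_property_dim_2:
  assumes pq: "UNIV = {p, q}" "d p \<noteq> d q" and char: "(2 :: 'k) \<noteq> 0"
  shows "\<not> matrix_algebra.primeness_property \<Gamma>"
proof -
  define h where "h = d p - d q"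
  have ne: "p \<noteq> q" using pq by auto
  have sum: "sum f UNIV = f p + f q" for f :: "'n \<Rightarrow> 'k"
    using ne by (simp add: pq)
  define x where "x r = (if r = p then 1 else - 1 :: 'k)" for r
  have val: "\<exists>c. coords (matrix_algebra.eval_poly s (commutator_poly h n)) = scale_matrix c (diagonal_matrix x)"
    if s: "matrix_algebra.graded_subst \<Gamma> s" for s n
  proof -
    define X where "X = coords (s (h, n))"
    define Y where "Y = coords (s (- h, Suc n))"
    let ?c = "X $ p $ q * Y $ q $ p - X $ q $ p * Y $ p $ q"
    have "X $ r $ r = 0" "Y $ r $ r = 0" for r
      unfolding X_def Y_def using pq(2) by (auto intro!: coords_nth_eq_0 graded_substD[OF s] simp: h_def)
    then have "(X ** Y - Y ** X) $ r $ t = ?c * diagonal_matrix x $ r $ t" for r t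
      using UNIV_I[of r] UNIV_I[of t] ne unfolding pq(1)
      by (auto simp: matrix_matrix_mult_nth sum x_def)
    then show ?thesis
      by (intro exI[of _ ?c]) (simp add: commutator_poly_def matrix_algebra.eval_poly_simps coords_simps vec_eq_iff
          flip: X_def Y_def)
  qed
  have nonzero: "\<exists>s. matrix_algebra.graded_subst \<Gamma> s \<and> matrix_algebra.eval_poly s (commutator_poly h n) \<noteq> 0" for n
  proof -
    define s where "s v = (if v = (h, n) then of_coords (matrix_unit p q)
      else if v = (- h, Suc n) then of_coords (matrix_unit q p) else 0)" for v
    have "matrix_algebra.graded_subst \<Gamma> s"
      using of_coords_matrix_unit_mem[of p q] of_coords_matrix_unit_mem[of q p]
      by (auto simp: matrix_algebra.graded_subst_def s_def zero_mem h_def)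
    moreover have "coords (matrix_algebra.eval_poly s (commutator_poly h n)) $ p $ p = 1"
      using ne by (simp add: commutator_poly_def matrix_algebra.eval_poly_simps coords_simps s_def matrix_unit_mult)
    then have "matrix_algebra.eval_poly s (commutator_poly h n) \<noteq> 0"
      by (auto simp: coords_def)
    ultimately show ?thesis by blast
  qed
  obtain s t where st: "matrix_algebra.graded_subst \<Gamma> s" "matrix_algebra.eval_poly s (commutator_poly h 0) \<noteq> 0"
    "matrix_algebra.graded_subst \<Gamma> t" "matrix_algebra.eval_poly t (commutator_poly h 2) \<noteq> 0"
    using nonzero by meson
  show ?thesis
  proof (rule not_primeness_property_if_diagonal_values[OF _ _ _ val val st])
    show "x r * x r = 1" for r
      by (simp add: x_def)
    have "(1 :: 'k) \<noteq> - 1"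
      using char by (metis add.right_inverse one_add_one)
    then show "x p \<noteq> x q"
      using ne by (simp add: x_def)
    show "vars (commutator_poly h 0 :: ('k, 'g) graded_poly) \<inter> vars (commutator_poly h 2 :: ('k, 'g) graded_poly) = {}"
      using vars_commutator_poly[of h 0] vars_commutator_poly[of h 2] by fastforce
  qed
qed

text \<open>
  A cyclic analogue of the commutator: for a cube root of unity \<open>\<omega>\<close>, a cyclic shift of the factors multiplies the
  polynomial by a power of \<open>\<omega>\<close>.
\<close>

definition cyclic_poly :: "'k::field \<Rightarrow> 'g \<Rightarrow> 'g \<Rightarrow> 'g \<Rightarrow> nat \<Rightarrow> ('k, 'g) graded_poly"
  where "cyclic_poly \<omega> a b c n =
    (let x = variable (a, n); y = variable (b, n + 1); z = variable (c, n + 2)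
     in x * y * z + scalar \<omega> * (y * z * x) + scalar (\<omega>\<^sup>2) * (z * x * y))"

lemma vars_cyclic_poly: "vars (cyclic_poly \<omega> a b c n) \<subseteq> UNIV \<times> {n..<n + 3}"
  unfolding cyclic_poly_def Let_def by (intro vars_subset_intros) (auto simp: vars_variable vars_scalar)

text \<open>
  With pairwise distinct degrees, degree zero means diagonal. The degrees \<open>a\<close>, \<open>b\<close>, \<open>c\<close> are those of
  the matrix units along the cycle \<open>i\<close>, \<open>j\<close>, \<open>k\<close>, and the cyclic weights turn the values into
  multiples of \<open>diag(1, \<omega>, \<omega>\<^sup>2)\<close>. The inverse of this matrix belongs to \<open>\<omega>\<^sup>2\<close> in place of \<open>\<omega>\<close>.
  In general each cyclic monomial has at most one nonzero diagonal entry; three of them occur only if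
  \<open>a = b = c\<close>, and the same computation covers both situations.
\<close>

lemma (in elementary_grading) not_primeness_property_distinct_degrees:
  assumes ijk: "UNIV = {i, j, k :: 'n}" "i \<noteq> j" "i \<noteq> k" "j \<noteq> k" and inj: "inj d"
    and \<omega>: "\<omega> ^ 3 = 1" "\<omega> \<noteq> (1 :: 'k)"
  shows "\<not> matrix_algebra.primeness_property \<Gamma>"
proof -
  define a b c where "a = d i - d j" and "b = d j - d k" and "c = d k - d i"
  note abc_def = a_def b_def c_def
  note ne = ijk(2-4) ijk(2-4)[symmetric]
  have d_ne: "d i \<noteq> d j" "d i \<noteq> d k" "d j \<noteq> d k"
    using ne inj by (auto simp: inj_eq)
  have sum: "sum f UNIV = f i + f j + f k" for f :: "'n \<Rightarrow> 'k"
    using ne by (simp add: ijk(1) add.assoc)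
  define x where "x \<omega> r = (if r = i then 1 else if r = j then \<omega> else \<omega>\<^sup>2)" for \<omega> :: 'k and r
  have val: "\<exists>c'. coords (matrix_algebra.eval_poly s (cyclic_poly \<omega> a b c n)) = scale_matrix c' (diagonal_matrix (x \<omega>))"
    if s: "matrix_algebra.graded_subst \<Gamma> s" and \<omega>: "\<omega> ^ 3 = 1" for s n \<omega>
  proof -
    let ?F = "matrix_algebra.eval_poly s (cyclic_poly \<omega> a b c n)"
    let ?x = "s (a, n)" and ?y = "s (b, n + 1)" and ?z = "s (c, n + 2)"
    define X Y Z where "X = coords ?x" and "Y = coords ?y" and "Z = coords ?z"
    note mem = graded_substD[OF s]
    note mult = matrix_algebra.grading_mult[OF grading]
    have F: "?F = ?x ** ?y ** ?z + scale_matrix \<omega> (?y ** ?z ** ?x) + scale_matrix (\<omega>\<^sup>2) (?z ** ?x ** ?y)"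
      by (simp add: cyclic_poly_def Let_def matrix_algebra.eval_poly_simps matrix_algebra.mult_scale_left
          matrix_algebra.one_mult)
    have "?x ** ?y ** ?z \<in> \<Gamma> 0" "?y ** ?z ** ?x \<in> \<Gamma> 0" "?z ** ?x ** ?y \<in> \<Gamma> 0"
      using mult[OF mult[OF mem[of a n] mem[of b "n + 1"]] mem[of c "n + 2"]]
        mult[OF mult[OF mem[of b "n + 1"] mem[of c "n + 2"]] mem[of a n]]
        mult[OF mult[OF mem[of c "n + 2"] mem[of a n]] mem[of b "n + 1"]]
      by (simp_all add: abc_def)
    then have "?F \<in> \<Gamma> 0"
      unfolding F using matrix_algebra.grading_subspace[OF grading]
      by (intro matrix_algebra.subspace_add matrix_algebra.subspace_scale)
    then have off_diagonal: "coords ?F $ r $ t = 0" if "r \<noteq> t" for r t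
      using that inj by (intro coords_nth_eq_0) (auto simp: inj_eq)
    \<comment> \<open>Coincidences between \<open>a\<close>, \<open>b\<close>, \<open>c\<close> and their negatives are allowed, so further entries off the
      cycle may survive. These zeros hold in every case and suffice.\<close>
    have X: "X $ r $ r = 0" "X $ i $ k = 0" "X $ k $ j = 0"
      and Y: "Y $ r $ r = 0" "Y $ j $ i = 0" "Y $ i $ k = 0"
      and Z: "Z $ r $ r = 0" "Z $ k $ j = 0" "Z $ j $ i = 0" for r
      unfolding X_def Y_def Z_def using d_ne
      by (auto intro!: coords_nth_eq_0[OF mem] simp: abc_def)
    have coords_F: "coords ?F = X ** Y ** Z + scale_matrix \<omega> (Y ** Z ** X) + scale_matrix (\<omega>\<^sup>2) (Z ** X ** Y)"
      by (simp only: F coords_simps X_def Y_def Z_def)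
    let ?P = "X $ i $ j * Y $ j $ k * Z $ k $ i"
    let ?Q = "X $ j $ k * Y $ k $ i * Z $ i $ j"
    let ?R = "X $ k $ i * Y $ i $ j * Z $ j $ k"
    have diag: "coords ?F $ i $ i = ?P + \<omega> * ?R + \<omega>\<^sup>2 * ?Q"
      "coords ?F $ j $ j = ?Q + \<omega> * ?P + \<omega>\<^sup>2 * ?R"
      "coords ?F $ k $ k = ?R + \<omega> * ?Q + \<omega>\<^sup>2 * ?P"
      by (simp_all add: coords_F matrix_matrix_mult_nth sum X Y Z)
    have x: "x \<omega> i = 1" "x \<omega> j = \<omega>" "x \<omega> k = \<omega>\<^sup>2"
      using ne by (simp_all add: x_def)
    have on_diagonal: "coords ?F $ r $ r = coords ?F $ i $ i * x \<omega> r" for r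
    proof -
      consider "r = i" | "r = j" | "r = k"
        using UNIV_I[of r] unfolding ijk(1) by blast
      then show ?thesis
      proof cases
        case 2
        show ?thesis
          unfolding 2 diag x using \<omega> by algebra
      next
        case 3
        show ?thesis
          unfolding 3 diag x using \<omega> by algebra
      qed (simp add: x)
    qed
    have "coords ?F $ r $ t = coords ?F $ i $ i * diagonal_matrix (x \<omega>) $ r $ t" for r t
    proof (cases "r = t")
      case True
      then show ?thesis using on_diagonal[of r] by simp
    next
      case False
      then show ?thesis by (simp add: off_diagonal)
    qed
    then show ?thesis
      unfolding vec_eq_iff scale_matrix_nth by blast
  qed
  have nonzero: "\<exists>s. matrix_algebra.graded_subst \<Gamma> s \<and> matrix_algebra.eval_poly s (cyclic_poly \<omega> a b c n) \<noteq> 0" for n \<omega>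
  proof -
    define s where "s v = (if v = (a, n) then of_coords (matrix_unit i j)
      else if v = (b, n + 1) then of_coords (matrix_unit j k)
      else if v = (c, n + 2) then of_coords (matrix_unit k i) else 0)" for v
    have "matrix_algebra.graded_subst \<Gamma> s"
      using of_coords_matrix_unit_mem
      by (auto simp: matrix_algebra.graded_subst_def s_def zero_mem abc_def)
    moreover have "coords (matrix_algebra.eval_poly s (cyclic_poly \<omega> a b c n)) $ i $ i = 1"
      using ne by (simp add: cyclic_poly_def Let_def matrix_algebra.eval_poly_simps coords_simps s_def
          matrix_unit_mult matrix_algebra.mult_scale_left)
    then have "matrix_algebra.eval_poly s (cyclic_poly \<omega> a b c n) \<noteq> 0"
      by (auto simp: coords_def)
    ultimately show ?thesis by blast
  qed
  have \<omega>2: "(\<omega>\<^sup>2) ^ 3 = 1"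
    using \<omega>(1) by algebra
  obtain s t where st: "matrix_algebra.graded_subst \<Gamma> s" "matrix_algebra.eval_poly s (cyclic_poly \<omega> a b c 0) \<noteq> 0"
    "matrix_algebra.graded_subst \<Gamma> t" "matrix_algebra.eval_poly t (cyclic_poly (\<omega>\<^sup>2) a b c 3) \<noteq> 0"
    using nonzero by meson
  show ?thesis
  proof (rule not_primeness_property_if_diagonal_values[OF _ _ _ val val st])
    show "x \<omega> r * x (\<omega>\<^sup>2) r = 1" for r
      using \<omega>(1) by (simp add: x_def power2_eq_square power3_eq_cube mult.assoc)
    show "x \<omega> i \<noteq> x \<omega> j"
      using ne \<omega>(2) by (simp add: x_def)
    show "vars (cyclic_poly \<omega> a b c 0) \<inter> vars (cyclic_poly (\<omega>\<^sup>2) a b c 3) = {}"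
      using vars_cyclic_poly[of \<omega> a b c 0] vars_cyclic_poly[of "\<omega>\<^sup>2" a b c 3] by fastforce
  qed (use \<omega> \<omega>2 in auto)
qed

text \<open>
  With \<open>t\<close> and \<open>m\<close> traceless on a two-dimensional block, \<open>t m + m t\<close> is the scalar \<open>trace (t m)\<close>
  there. The last summand produces the same scalar on the complementary one-dimensional block, as
  \<open>y s x = trace (s x y)\<close> for a column \<open>x\<close> and a row \<open>y\<close>; the choice \<open>s = w t - t w\<close> comes from
  \<open>trace (t (x y w - w x y)) = trace ((w t - t w) x y)\<close>.
\<close>

definition block_poly :: "'g::ab_group_add \<Rightarrow> nat \<Rightarrow> ('k::field, 'g) graded_poly"
  where "block_poly h n =
    (let u = variable (0, n); v = variable (0, n + 1); w = variable (0, n + 2);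
         x = variable (h, n + 3); y = variable (- h, n + 4);
         t = u * v - v * u; m = x * y * w - w * (x * y)
     in t * m + m * t - y * (w * t - t * w) * x)"

lemma vars_block_poly:
  "vars (block_poly h n :: ('k::field, 'g::ab_group_add) graded_poly) \<subseteq> UNIV \<times> {n..<n + 5}"
  unfolding block_poly_def Let_def by (intro vars_subset_intros) (auto simp: vars_variable)

text \<open>
  The degree-zero part is block diagonal with a full block at \<open>p\<close>, \<open>q\<close> and a scalar at \<open>r\<close>, and
  conjugation by its units preserves the values of a polynomial. Hence a matrix that spans
  all values has to be scalar on the block. The values are multiples of
  \<open>diag(1, 1, -1)\<close>, which is its own inverse.
\<close>

lemma (in elementary_grading) not_primeness_property_two_equal_degrees:
  assumes pqr: "UNIV = {p, q, r}" "p \<noteq> q" and d: "d p = d q" "d p \<noteq> d r" and char: "(2 :: 'k) \<noteq> 0"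
  shows "\<not> matrix_algebra.primeness_property \<Gamma>"
proof -
  define h where "h = d p - d r"
  have "p \<noteq> r" "q \<noteq> r" using d by auto
  note ne = this this[symmetric] pqr(2) pqr(2)[symmetric]
  have sum: "sum f UNIV = f p + f q + f r" for f :: "'n \<Rightarrow> 'k"
    using ne by (simp add: pqr(1) add.assoc)
  define x where "x i = (if i = r then - 1 else 1 :: 'k)" for i
  have val: "\<exists>c. coords (matrix_algebra.eval_poly s (block_poly h n)) = scale_matrix c (diagonal_matrix x)"
    if s: "matrix_algebra.graded_subst \<Gamma> s" for s n
  proof -
    define U V W X Y where "U = coords (s (0, n))" and "V = coords (s (0, n + 1))"
      and "W = coords (s (0, n + 2))" and "X = coords (s (h, n + 3))" and "Y = coords (s (- h, n + 4))"
    note defs = U_def V_def W_def X_def Y_def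
    note mem = graded_substD[OF s]
    have degree_0: "coords (s (0, m)) $ i $ r = 0" "coords (s (0, m)) $ r $ i = 0" if "i \<noteq> r" for i m
      using that UNIV_I[of i] d unfolding pqr(1) by (auto intro!: coords_nth_eq_0[OF mem])
    note UVW = degree_0[of p n, folded U_def] degree_0[of q n, folded U_def]
      degree_0[of p "n + 1", folded V_def] degree_0[of q "n + 1", folded V_def]
      degree_0[of p "n + 2", folded W_def] degree_0[of q "n + 2", folded W_def]
    have XY: "X $ i $ i = 0" "X $ p $ q = 0" "X $ q $ p = 0"
      "Y $ i $ i = 0" "Y $ p $ q = 0" "Y $ q $ p = 0" for i
      unfolding X_def Y_def using d by (auto intro!: coords_nth_eq_0[OF mem] simp: h_def)
    define T where "T = U ** V - V ** U"
    define M where "M = X ** Y ** W - W ** (X ** Y)"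
    have T: "T $ q $ q = - T $ p $ p" "T $ r $ i = 0" "T $ i $ r = 0" for i
      using UNIV_I[of i] ne unfolding pqr(1)
      by (auto simp: T_def matrix_matrix_mult_nth sum UVW algebra_simps)
    have M: "M $ q $ q = - M $ p $ p" "M $ r $ i = 0" "M $ i $ r = 0" for i
      using UNIV_I[of i] ne unfolding pqr(1)
      by (auto simp: M_def matrix_matrix_mult_nth sum UVW XY algebra_simps)
    \<comment> \<open>The trace of \<open>T ** M\<close> for traceless \<open>T\<close> and \<open>M\<close>.\<close>
    define c where "c = 2 * T $ p $ p * M $ p $ p + T $ p $ q * M $ q $ p + T $ q $ p * M $ p $ q"
    have "(T ** M + M ** T) $ i $ j = (if i = j \<and> i \<noteq> r then c else 0)" for i j
      using UNIV_I[of i] UNIV_I[of j] ne unfolding pqr(1)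
      by (auto simp: c_def matrix_matrix_mult_nth sum T M algebra_simps)
    moreover have "(Y ** (W ** T - T ** W) ** X) $ i $ j = (if i = r \<and> j = r then c else 0)" for i j
      using UNIV_I[of i] UNIV_I[of j] ne unfolding pqr(1)
      by (auto simp: c_def M_def matrix_matrix_mult_nth sum T UVW XY algebra_simps)
    ultimately have "(T ** M + M ** T - Y ** (W ** T - T ** W) ** X) $ i $ j = c * diagonal_matrix x $ i $ j" for i j
      by (simp add: x_def)
    then have "coords (matrix_algebra.eval_poly s (block_poly h n)) = scale_matrix c (diagonal_matrix x)"
      unfolding block_poly_def Let_def matrix_algebra.eval_poly_simps coords_simps
        defs[symmetric] T_def[symmetric] M_def[symmetric]
      by (simp add: vec_eq_iff)
    then show ?thesis ..
  qed
  have nonzero: "\<exists>s. matrix_algebra.graded_subst \<Gamma> s \<and> matrix_algebra.eval_poly s (block_poly h n) \<noteq> 0" for n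
  proof -
    define s where "s v = (if v = (0, n) then of_coords (matrix_unit p q)
      else if v = (0, n + 1) \<or> v = (0, n + 2) then of_coords (matrix_unit q p)
      else if v = (h, n + 3) then of_coords (matrix_unit p r)
      else if v = (- h, n + 4) then of_coords (matrix_unit r q) else 0)" for v
    have "matrix_algebra.graded_subst \<Gamma> s"
      using of_coords_matrix_unit_mem[of p q] of_coords_matrix_unit_mem[of q p]
        of_coords_matrix_unit_mem[of p r] of_coords_matrix_unit_mem[of r q] d
      by (auto simp: matrix_algebra.graded_subst_def s_def zero_mem h_def)
    moreover have "coords (matrix_algebra.eval_poly s (block_poly h n)) $ p $ p = 2"
      using ne by (simp add: block_poly_def Let_def matrix_algebra.eval_poly_simps coords_simps s_def
          matrix_unit_mult matrix_matrix_mult_nth sum)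
    then have "matrix_algebra.eval_poly s (block_poly h n) \<noteq> 0"
      using char by (auto simp: coords_def)
    ultimately show ?thesis by blast
  qed
  obtain s t where st: "matrix_algebra.graded_subst \<Gamma> s" "matrix_algebra.eval_poly s (block_poly h 0) \<noteq> 0"
    "matrix_algebra.graded_subst \<Gamma> t" "matrix_algebra.eval_poly t (block_poly h 5) \<noteq> 0"
    using nonzero by meson
  show ?thesis
  proof (rule not_primeness_property_if_diagonal_values[OF _ _ _ val val st])
    show "x i * x i = 1" for i
      by (simp add: x_def)
    have "(1 :: 'k) \<noteq> - 1"
      using char by (metis add.right_inverse one_add_one)
    then show "x p \<noteq> x r"
      using ne by (simp add: x_def)
    show "vars (block_poly h 0 :: ('k, 'g) graded_poly) \<inter> vars (block_poly h 5 :: ('k, 'g) graded_poly) = {}"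
      using vars_block_poly[of h 0] vars_block_poly[of h 5] by fastforce
  qed
qed

section \<open>Matrices of order two and three\<close>

lemma ex_primitive_cube_root:
  "\<exists>\<omega> :: 'k::{alg_closed_field,field_char_0}. \<omega> ^ 3 = 1 \<and> \<omega> \<noteq> 1"
proof -
  have "degree [:1, 1, 1 :: 'k:] > 0" by simp
  then obtain \<omega> :: 'k where \<omega>: "poly [:1, 1, 1:] \<omega> = 0"
    using alg_closed_imp_poly_has_root by blast
  then have "1 + \<omega> + \<omega>\<^sup>2 = 0"
    by (simp add: algebra_simps power2_eq_square)
  then have "\<omega> ^ 3 = 1" by algebra
  moreover have "\<omega> \<noteq> 1"
  proof
    assume "\<omega> = 1"
    with \<omega> have "(3 :: 'k) = 0" by simp
    then show False by simp
  qed
  ultimately show ?thesis by blast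
qed

lemma (in elementary_grading) not_primeness_property_dim_3:
  assumes card: "CARD('n) = 3" and nontriv: "\<not> matrix_algebra.trivial_grading \<Gamma>"
    and char: "(2 :: 'k) \<noteq> 0" and \<omega>: "\<omega> ^ 3 = 1" "\<omega> \<noteq> (1 :: 'k)"
  shows "\<not> matrix_algebra.primeness_property \<Gamma>"
proof (cases "inj d")
  case True
  obtain i j k where "UNIV = {i, j, k :: 'n}" "i \<noteq> j" "i \<noteq> k" "j \<noteq> k"
    using card by (metis card_3_iff)
  then show ?thesis
    using not_primeness_property_distinct_degrees True \<omega> by blast
next
  case False
  then obtain p q where pq: "p \<noteq> q" "d p = d q"
    by (auto simp: inj_def)
  have "card (UNIV - {p, q}) = 1"
    using card pq by (simp add: card_Diff_subset)
  then obtain r where r: "UNIV - {p, q} = {r}"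
    by (auto simp: card_1_singleton_iff)
  then have UNIV: "UNIV = {p, q, r}" by blast
  have "d p \<noteq> d r"
  proof
    assume "d p = d r"
    then have "d i = d p" for i
      using UNIV_I[of i] pq unfolding UNIV by auto
    then show False
      using degree_not_constant[OF nontriv] by metis
  qed
  then show ?thesis
    using not_primeness_property_two_equal_degrees UNIV pq char by blast
qed

theorem theorem25:
  fixes k :: nat
  assumes "k \<in> {2, 3}" and "CARD('n::finite) = k"
  shows "\<not> (\<exists>\<Gamma> :: 'g::{finite,ab_group_add} \<Rightarrow>
      ('k::{alg_closed_field,field_char_0}^'n^'n) set.
    matrix_algebra.grading \<Gamma> \<and> \<not> matrix_algebra.trivial_grading \<Gamma> \<and>
    matrix_algebra.primeness_property \<Gamma>)"
proof -
  have "\<not> matrix_algebra.primeness_property \<Gamma>"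
    if \<Gamma>: "matrix_algebra.grading \<Gamma>" and nontriv: "\<not> matrix_algebra.trivial_grading \<Gamma>"
    for \<Gamma> :: "'g \<Rightarrow> ('k^'n^'n) set"
  proof (cases "\<forall>M\<in>\<Gamma> 0. \<exists>c. M = scale_matrix c (mat 1)")
    case True
    then show ?thesis
      using not_primeness_property_if_degree_zero_scalar[OF \<Gamma> nontriv] by blast
  next
    case False
    then obtain M where M: "M \<in> \<Gamma> 0" "\<And>c. M \<noteq> scale_matrix c (mat 1)" by blast
    have card_le: "CARD('n) \<le> 3"
      using assms by auto
    obtain v w where vw: "rank_one_matrix v w \<in> \<Gamma> 0" "(\<Sum>i\<in>UNIV. w $ i * v $ i) = 1"
      using ex_rank_one_idempotent_degree_zero[OF \<Gamma> card_le M] by blast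
    obtain P Q and d :: "'n \<Rightarrow> 'g" where coords: "P ** Q = mat 1" "Q ** P = mat 1"
      "\<And>g M. M \<in> \<Gamma> g \<longleftrightarrow> (\<forall>i j. (Q ** M ** P) $ i $ j \<noteq> 0 \<longrightarrow> d i - d j = g)"
      using ex_homogeneous_coordinates[OF \<Gamma> vw] by blast
    interpret elementary_grading \<Gamma> P Q d
      by unfold_locales (use \<Gamma> coords in auto)
    obtain i j where ij: "d i \<noteq> d j"
      using degree_not_constant[OF nontriv] by blast
    show ?thesis
    proof (cases "k = 2")
      case True
      then have "card (UNIV :: 'n set) = card {i, j}"
        using ij assms by (auto simp: card_insert_if)
      then have "UNIV = {i, j}"
        using card_subset_eq[of UNIV "{i, j}"] by auto
      then show ?thesis
        using not_primeness_property_dim_2 ij by simp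
    next
      case False
      then have "CARD('n) = 3"
        using assms by auto
      then show ?thesis
        using not_primeness_property_dim_3 nontriv ex_primitive_cube_root[where 'k = 'k] by auto
    qed
  qed
  then show ?thesis by blast
qed

end
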